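(* For finite groups, either the power graph or the enhanced power graph determines the cyclic subgroup graph up to isomorphism. That is, let $G_1$ and $G_2$ be finite groups. If the power graphs of $G_1$ and $G_2$ are isomorphic, then $\Gamma(G_1)\cong\Gamma(G_2)$; and if the enhanced power graphs of $G_1$ and $G_2$ are isomorphic, then $\Gamma(G_1)\cong\Gamma(G_2)$.
   Context: For a finite group $G$, the cyclic subgroup graph $\Gamma(G)$ is the simple undirected graph whose vertex set is $C(G)$, the set of all cyclic subgroups of $G$ (including the trivial subgroup $\{e\}$), and in which two distinct vertices are adjacent if and only if one of them, $H_1$, is contained in the other, $H_2$, and there is no subgroup $K$ of $G$ with $H_1<K<H_2$ (strict inclusions). The power graph of $G$ is the simple undirected graph with vertex set $G$ in which distinct elements $x,y$ are adjacent if one of $x$ and $y$ is a power of the other. The enhanced power graph of $G$ is the simple undirected graph with vertex set $G$ in which distinct elements $x,y$ are adjacent if there exists $z\in G$ such that both $x$ and $y$ are powers of $z$. *)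

theory Defs
  imports "HOL-Algebra.Elementary_Groups" "Graph_Theory.Graph_Theory"
begin

definition cyclic_subgroups :: "('a, 'b) monoid_scheme \<Rightarrow> 'a set set" where
  "cyclic_subgroups G = {H. subgroup H G \<and> cyclic_group (G\<lparr>carrier := H\<rparr>)}"

text \<open>Simple undirected graphs are represented as in \<open>Graph_Theory\<close>: symmetric loop-free
  digraphs without parallel arcs (locale \<^locale>\<open>pair_graph\<close>, established below).\<close>

definition subgroup_covers :: "('a, 'b) monoid_scheme \<Rightarrow> 'a set \<Rightarrow> 'a set \<Rightarrow> bool" where
  "subgroup_covers G H1 H2 \<longleftrightarrow> H1 \<subset> H2 \<and> \<not> (\<exists>K. subgroup K G \<and> H1 \<subset> K \<and> K \<subset> H2)"

definition cyclic_subgroup_graph :: "('a, 'b) monoid_scheme \<Rightarrow> 'a set pair_pre_digraph" where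
  "cyclic_subgroup_graph G =
     \<lparr> pverts = cyclic_subgroups G,
       parcs = {(H1, H2). H1 \<in> cyclic_subgroups G \<and> H2 \<in> cyclic_subgroups G \<and> H1 \<noteq> H2 \<and>
                  (subgroup_covers G H1 H2 \<or> subgroup_covers G H2 H1)} \<rparr>"

text \<open>Exponents are integers; for elements of finite order this agrees with natural exponents.\<close>

definition is_power_of :: "('a, 'b) monoid_scheme \<Rightarrow> 'a \<Rightarrow> 'a \<Rightarrow> bool" where
  "is_power_of G x z \<longleftrightarrow> (\<exists>n::int. x = z [^]\<^bsub>G\<^esub> n)"

definition power_graph :: "('a, 'b) monoid_scheme \<Rightarrow> 'a pair_pre_digraph" where
  "power_graph G =
     \<lparr> pverts = carrier G,
       parcs = {(x, y). x \<in> carrier G \<and> y \<in> carrier G \<and> x \<noteq> y \<and>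
                  (is_power_of G x y \<or> is_power_of G y x)} \<rparr>"

definition enhanced_power_graph :: "('a, 'b) monoid_scheme \<Rightarrow> 'a pair_pre_digraph" where
  "enhanced_power_graph G =
     \<lparr> pverts = carrier G,
       parcs = {(x, y). x \<in> carrier G \<and> y \<in> carrier G \<and> x \<noteq> y \<and>
                  (\<exists>z\<in>carrier G. is_power_of G x z \<and> is_power_of G y z)} \<rparr>"

lemma cyclic_subgroups_eq:
  assumes "group G"
  shows "cyclic_subgroups G = (\<lambda>x. range (\<lambda>n::int. x [^]\<^bsub>G\<^esub> n)) ` carrier G"
proof -
  interpret group G by fact
  have pow: "x [^]\<^bsub>G\<lparr>carrier := H\<rparr>\<^esub> (n::int) = x [^]\<^bsub>G\<^esub> n" if "subgroup H G" "x \<in> H" for H x n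
    using int_pow_consistent[OF that] by simp
  have cyc: "cyclic_group (G\<lparr>carrier := H\<rparr>) \<longleftrightarrow> (\<exists>x\<in>H. H = range (\<lambda>n::int. x [^]\<^bsub>G\<^esub> n))"
    if "subgroup H G" for H
    using group.cyclic_group[OF subgroup.subgroup_is_group[OF that is_group]] pow[OF that]
    by simp
  have sub: "subgroup (range (\<lambda>n::int. x [^]\<^bsub>G\<^esub> n)) G" if "x \<in> carrier G" for x
    using generate_is_subgroup[of "{x}"] generate_pow[OF that] that by (simp add: full_SetCompr_eq)
  have mem: "x \<in> range (\<lambda>n::int. x [^]\<^bsub>G\<^esub> n)" if "x \<in> carrier G" for x
    using that by (intro range_eqI[of _ _ 1]) simp
  show ?thesis
  proof (intro equalityI subsetI)
    fix H assume "H \<in> cyclic_subgroups G"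
    then have H: "subgroup H G" and "cyclic_group (G\<lparr>carrier := H\<rparr>)"
      by (auto simp: cyclic_subgroups_def)
    then obtain x where "x \<in> H" "H = range (\<lambda>n::int. x [^]\<^bsub>G\<^esub> n)"
      using cyc[OF H] by blast
    then show "H \<in> (\<lambda>x. range (\<lambda>n::int. x [^]\<^bsub>G\<^esub> n)) ` carrier G"
      using subgroup.subset[OF H] by blast
  next
    fix H assume "H \<in> (\<lambda>x. range (\<lambda>n::int. x [^]\<^bsub>G\<^esub> n)) ` carrier G"
    then obtain x where x: "x \<in> carrier G" and H: "H = range (\<lambda>n::int. x [^]\<^bsub>G\<^esub> n)" by blast
    then have "subgroup H G" "x \<in> H" using sub mem by auto
    then show "H \<in> cyclic_subgroups G"
      using cyc H by (auto simp only: cyclic_subgroups_def)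
  qed
qed

lemma pair_graphI_simple:
  assumes "finite (pverts A)" "parcs A \<subseteq> pverts A \<times> pverts A" "sym (parcs A)" "irrefl (parcs A)"
  shows "pair_graph A"
proof -
  have "finite (parcs A)"
    using assms(1,2) by (meson finite_SigmaI finite_subset)
  then show ?thesis
    using assms by unfold_locales (auto simp: symmetric_def irrefl_def)
qed

lemma finite_cyclic_subgroups: "finite (carrier G) \<Longrightarrow> finite (cyclic_subgroups G)"
  by (rule finite_subset[of _ "Pow (carrier G)"])
     (auto simp: cyclic_subgroups_def dest: subgroup.subset)

lemma
  assumes "finite (carrier G)"
  shows pair_graph_power_graph: "pair_graph (power_graph G)"
    and pair_graph_enhanced_power_graph: "pair_graph (enhanced_power_graph G)"
    and pair_graph_cyclic_subgroup_graph: "pair_graph (cyclic_subgroup_graph G)"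
  using assms finite_cyclic_subgroups[OF assms]
  by (auto intro!: pair_graphI_simple symI simp: irrefl_def
        power_graph_def enhanced_power_graph_def cyclic_subgroup_graph_def)

text \<open>On such graphs the library's isomorphism relation is the usual one: an
  adjacency-preserving and adjacency-reflecting bijection of the vertex sets.\<close>

lemma digraph_iso_with_proj_iff:
  assumes "pair_wf_digraph A" "pair_wf_digraph B"
  shows "digraph_iso (with_proj A) (with_proj B) \<longleftrightarrow>
    (\<exists>f. bij_betw f (pverts A) (pverts B) \<and>
      (\<forall>x\<in>pverts A. \<forall>y\<in>pverts A. (x, y) \<in> parcs A \<longleftrightarrow> (f x, f y) \<in> parcs B))"
    (is "?L \<longleftrightarrow> (\<exists>f. ?P f)")
proof
  interpret A: pair_wf_digraph A by fact
  assume ?L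
  then obtain h where h: "pre_digraph.digraph_isomorphism (with_proj A) h"
    and B: "with_proj B = app_iso h (with_proj A)"
    by (auto simp: digraph_iso_def)
  let ?f = "iso_verts h"
  have inj: "inj_on ?f (pverts A)"
    and ends: "\<And>a. a \<in> parcs A \<Longrightarrow>
      ?f (fst a) = iso_tail h (iso_arcs h a) \<and> ?f (snd a) = iso_head h (iso_arcs h a)"
    using h by (auto simp: pre_digraph.digraph_isomorphism_def)
  have V: "pverts B = ?f ` pverts A" and E: "parcs B = iso_arcs h ` parcs A"
    and t: "iso_tail h = fst" and hd: "iso_head h = snd"
    using arg_cong[OF B, of verts] arg_cong[OF B, of arcs]
      arg_cong[OF B, of tail] arg_cong[OF B, of head] by simp_all
  have arcs: "iso_arcs h a = (?f (fst a), ?f (snd a))" if "a \<in> parcs A" for a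
    using ends[OF that] t hd by (simp add: prod_eq_iff)
  have "(x, y) \<in> parcs A \<longleftrightarrow> (?f x, ?f y) \<in> parcs B" if "x \<in> pverts A" "y \<in> pverts A" for x y
  proof
    assume "(x, y) \<in> parcs A"
    then show "(?f x, ?f y) \<in> parcs B"
      unfolding E using arcs by force
  next
    assume "(?f x, ?f y) \<in> parcs B"
    then obtain a where a: "a \<in> parcs A" "(?f x, ?f y) = (?f (fst a), ?f (snd a))"
      unfolding E using arcs by auto
    then have "x = fst a" "y = snd a"
      using that inj A.arc_fst_in_verts A.arc_snd_in_verts by (auto dest: inj_onD)
    then show "(x, y) \<in> parcs A" using a by simp
  qed
  then show "\<exists>f. ?P f"
    using inj V by (auto simp: bij_betw_def)
next
  interpret A: pair_wf_digraph A by fact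
  interpret B: pair_wf_digraph B by fact
  assume "\<exists>f. ?P f"
  then obtain f where inj: "inj_on f (pverts A)" and V: "f ` pverts A = pverts B"
    and adj: "\<And>x y. x \<in> pverts A \<Longrightarrow> y \<in> pverts A \<Longrightarrow> (x, y) \<in> parcs A \<longleftrightarrow> (f x, f y) \<in> parcs B"
    by (auto simp: bij_betw_def)
  let ?h = "\<lparr> iso_verts = f, iso_arcs = map_prod f f, iso_head = snd, iso_tail = fst \<rparr>"
  have sub: "parcs A \<subseteq> pverts A \<times> pverts A"
    using A.arc_fst_in_verts A.arc_snd_in_verts by fastforce
  have inj2: "inj_on (map_prod f f) (parcs A)"
    using map_prod_inj_on[OF inj inj] sub by (rule inj_on_subset)
  have "parcs B \<subseteq> map_prod f f ` parcs A"
  proof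
    fix e assume e: "e \<in> parcs B"
    obtain u v where uv: "e = (u, v)" by (cases e)
    then have "u \<in> f ` pverts A" "v \<in> f ` pverts A"
      using e B.in_arcsD1 B.in_arcsD2 V by auto
    then obtain x y where "x \<in> pverts A" "y \<in> pverts A" "u = f x" "v = f y" by auto
    then show "e \<in> map_prod f f ` parcs A"
      using e uv adj by (auto intro!: image_eqI[of _ _ "(x, y)"])
  qed
  moreover have "map_prod f f ` parcs A \<subseteq> parcs B"
  proof
    fix e assume "e \<in> map_prod f f ` parcs A"
    then obtain x y where "(x, y) \<in> parcs A" "e = (f x, f y)" by auto
    then show "e \<in> parcs B"
      using adj[of x y] A.in_arcsD1[of x y] A.in_arcsD2[of x y] by blast
  qed
  ultimately have E: "map_prod f f ` parcs A = parcs B" by blast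
  have "pre_digraph.digraph_isomorphism (with_proj A) ?h"
    using inj inj2 A.wf_digraph by (simp add: pre_digraph.digraph_isomorphism_def)
  moreover have "with_proj B = app_iso ?h (with_proj A)"
    by (simp add: app_iso_def with_proj_def V E)
  ultimately show ?L
    unfolding digraph_iso_def by blast
qed

end

theory Submission
  imports Defs "HOL-Algebra.Multiplicative_Group" "HOL-Number_Theory.Totient"
    "HOL-Combinatorics.Transposition"
begin

text \<open>
  Write \<open>x \<preceq> y\<close> when \<open>x\<close> is a power of \<open>y\<close>, that is, when \<open>\<langle>x\<rangle> \<le> \<langle>y\<rangle>\<close>. The cyclic subgroup graph is
  the Hasse diagram of the poset of cyclic subgroups, so it is enough to construct a relation
  between the elements of the two groups that is total on both sides and preserves and reflects
  \<open>\<preceq>\<close> (lemma \<open>cyclic_subgroup_graph_iso\<close>). An isomorphism \<open>f\<close> of the given graphs need not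
  preserve \<open>\<preceq>\<close> itself, but it can be corrected.

  \<^emph>\<open>Enhanced power graph.\<close> Elements that are pairwise contained in a common cyclic subgroup are
  all contained in one (\<open>pairwise_cocyclic_imp_cyclic\<close>). The maximal cliques are therefore the
  maximal cyclic subgroups; \<open>f\<close> maps those of one group to those of the other and preserves the
  orders of their pairwise intersections.
  An element \<open>x\<close> of a maximal cyclic subgroup \<open>M\<close> is matched with the elements of \<open>f M\<close> of the
  same order. A cyclic group has one subgroup of each order dividing its own, so the subgroup
  generated by a match does not depend on \<open>M\<close>, because \<open>M \<inter> M'\<close> and \<open>f M \<inter> f M'\<close> have the same
  order (\<open>power_le_transfer\<close>).

  \<^emph>\<open>Power graph.\<close> Let \<open>N x\<close> be the closed neighbourhood of \<open>x\<close>. One may assume that \<open>f\<close> fixes the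
  identity, because the identity and its image are both adjacent to everything. Call two elements
  twins if \<open>N x = N y\<close>. Generators of the same cyclic subgroup are twins. If a class of non-identity
  twins contains more than the generators of one subgroup, then it consists of the
  elements of order at least \<open>p\<^sup>s\<close> in a cyclic group of prime power order \<open>p\<^sup>r\<close>, where \<open>0 < s < r\<close>
  (\<open>not_plain_imp_layered\<close>). It then has \<open>p ^ r - p ^ (s - 1)\<close> elements, and \<open>p\<^sup>r\<close> elements \<open>v\<close> satisfy
  \<open>N x \<subseteq> N v\<close>. Comparing these two numbers and, in one critical case, the sizes of
  adjacent classes shows that \<open>f\<close> maps a class of this kind to another with
  the same \<open>p\<close>, \<open>r\<close> and \<open>s\<close> (\<open>not_plain_f\<close>), and, by symmetry, a class consisting of
  the generators of one subgroup to another of that form (\<open>plain_f\<close>).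
  Hence \<open>x\<close> can be matched with a twin \<open>y\<close> of \<open>f x\<close> that generates a
  subgroup with equally many generators (\<open>exists_matched\<close>). Matching preserves comparability. It
  preserves the direction of \<open>\<preceq>\<close> because the number \<open>\<phi>(n)\<close> of generators grows with the subgroup,
  with the one exception \<open>\<phi>(n) = \<phi>(2 n)\<close> for odd \<open>n\<close>, where an involution tells the two apart
  (\<open>matched_power_le\<close>).
\<close>

section \<open>Powers and cyclic subgroups in a finite group\<close>

lemma pair_wf_cyclic_subgroup_graph: "pair_wf_digraph (cyclic_subgroup_graph G)"
  and pair_wf_power_graph: "pair_wf_digraph (power_graph G)"
  and pair_wf_enhanced_power_graph: "pair_wf_digraph (enhanced_power_graph G)"
  by (unfold_locales; auto simp: cyclic_subgroup_graph_def power_graph_def enhanced_power_graph_def)+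

text \<open>In a finite group, \<open>x \<preceq> y\<close> means that \<open>x\<close> is a power of \<open>y\<close>; the cyclic subgroup \<open>\<langle>x\<rangle>\<close> is the set
  \<open>{w. w \<preceq> x}\<close>.\<close>

locale finite_group = group +
  assumes finite_carrier: "finite (carrier G)"
begin

abbreviation power_le :: "'a \<Rightarrow> 'a \<Rightarrow> bool" (infix "\<preceq>" 50) where
  "x \<preceq> y \<equiv> is_power_of G x y"

lemma ord_pos: "x \<in> carrier G \<Longrightarrow> ord x > 0"
  using ord_ge_1[OF finite_carrier] by (simp add: Suc_le_eq)

lemma power_le_carrier: "\<lbrakk>x \<preceq> y; y \<in> carrier G\<rbrakk> \<Longrightarrow> x \<in> carrier G"
  by (auto simp: is_power_of_def)

lemma power_le_refl: "x \<in> carrier G \<Longrightarrow> x \<preceq> x"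
  unfolding is_power_of_def by (rule exI[of _ 1]) simp

lemma one_power_le: "\<one> \<preceq> x"
  unfolding is_power_of_def by (rule exI[of _ 0]) simp

lemma power_le_trans: "\<lbrakk>x \<preceq> y; y \<preceq> z; z \<in> carrier G\<rbrakk> \<Longrightarrow> x \<preceq> z"
  unfolding is_power_of_def by (metis int_pow_pow)

lemma power_le_nat_pow: "x [^] (k::nat) \<preceq> x"
  unfolding is_power_of_def by (metis int_pow_int)

lemma power_le_iff_nat_pow:
  assumes "y \<in> carrier G" shows "x \<preceq> y \<longleftrightarrow> (\<exists>k::nat. x = y [^] k)"
  using generate_pow_on_finite_carrier[OF finite_carrier assms] generate_pow[OF assms]
  unfolding is_power_of_def by (auto simp: set_eq_iff)

lemma power_le_mult: "\<lbrakk>u \<preceq> z; v \<preceq> z; z \<in> carrier G\<rbrakk> \<Longrightarrow> u \<otimes> v \<preceq> z"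
  unfolding is_power_of_def by (metis int_pow_mult)

lemma power_le_commute: "\<lbrakk>u \<preceq> z; v \<preceq> z; z \<in> carrier G\<rbrakk> \<Longrightarrow> u \<otimes> v = v \<otimes> u"
  unfolding is_power_of_def by (metis add.commute int_pow_mult)

lemma power_le_ord_dvd:
  assumes "x \<preceq> y" "y \<in> carrier G" shows "ord x dvd ord y"
proof -
  obtain i :: int where x: "x = y [^] i" using assms(1) by (auto simp: is_power_of_def)
  have "x [^] int (ord y) = \<one>"
    unfolding x using assms(2) by (simp add: int_pow_pow int_pow_eq_id)
  then show ?thesis
    using int_pow_eq_id[of x "int (ord y)"] power_le_carrier[OF assms] by simp
qed

text \<open>Inside a cyclic group, one element is a power of another as soon as its order divides the
  order of the other; hence there is only one cyclic subgroup of each order.\<close>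

lemma power_le_iff_ord_dvd:
  assumes "u \<preceq> z" "v \<preceq> z" and z: "z \<in> carrier G"
  shows "u \<preceq> v \<longleftrightarrow> ord u dvd ord v"
proof
  show "u \<preceq> v \<Longrightarrow> ord u dvd ord v"
    using power_le_ord_dvd power_le_carrier assms by blast
next
  assume dvd: "ord u dvd ord v"
  have vC: "v \<in> carrier G" and uC: "u \<in> carrier G" using power_le_carrier assms by blast+
  obtain i j :: int where u: "u = z [^] i" and v: "v = z [^] j"
    using assms by (auto simp: is_power_of_def)
  define n where "n = int (ord z)"
  define g where "g = gcd j n"
  have n: "n > 0" using ord_pos[OF z] by (simp add: n_def)
  have g: "g > 0" "g dvd n" "g dvd j" using n by (auto simp: g_def)
  obtain m where m: "n = g * m" using g by blast
  have "n dvd j * m" using g(3) m by auto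
  then have "v [^] m = \<one>" unfolding v using z by (simp add: int_pow_pow int_pow_eq_id n_def)
  then have "int (ord v) dvd m" using int_pow_eq_id[OF vC] by simp
  then have "int (ord u) dvd m" using dvd by (meson dvd_trans int_dvd_int_iff)
  then have "u [^] m = \<one>" using int_pow_eq_id[OF uC] by simp
  then have "n dvd i * m" unfolding u using z by (simp add: int_pow_pow int_pow_eq_id n_def)
  then have "g dvd i" using m n by auto
  then obtain t where t: "i = g * t" by blast
  obtain a b where ab: "a * j + b * n = g" using bezout_int unfolding g_def by blast
  have "u = v [^] (a * t)"
  proof -
    have "j * (a * t) - i = n * (- b * t)" unfolding t ab[symmetric] by (simp add: algebra_simps)
    then have "int (ord z) dvd j * (a * t) - i" unfolding n_def[symmetric] by simp
    then show ?thesis unfolding u v using z by (simp add: int_pow_pow int_pow_eq)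
  qed
  then show "u \<preceq> v" by (auto simp: is_power_of_def)
qed

lemma power_le_ord_antisym:
  assumes "z \<preceq> r" "ord r \<le> ord z" and r: "r \<in> carrier G"
  shows "r \<preceq> z"
proof -
  have "ord r = ord z"
    using power_le_ord_dvd[OF assms(1) r] assms(2) ord_pos[OF r] by (simp add: dvd_imp_le eq_iff)
  then show ?thesis using power_le_iff_ord_dvd[OF power_le_refl[OF r] assms(1) r] by simp
qed

lemma exists_power_of_order:
  assumes "z \<in> carrier G" "d dvd ord z"
  obtains w where "w \<preceq> z" "ord w = d"
proof
  have "ord z > 0" using ord_pos assms by blast
  then have "ord z div d dvd ord z" "ord z div d \<noteq> 0" "ord z div (ord z div d) = d"
    using assms(2) by (auto elim!: dvdE)
  then show "ord (z [^] (ord z div d)) = d" using ord_pow[OF assms(1)] by simp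
qed (rule power_le_nat_pow)

lemma finite_powers: "z \<in> carrier G \<Longrightarrow> finite {w. w \<preceq> z}"
  using power_le_carrier by (blast intro: finite_subset[OF _ finite_carrier])

lemma card_powers:
  assumes "z \<in> carrier G" shows "card {w. w \<preceq> z} = ord z"
proof -
  have "{w. w \<preceq> z} = generate G {z}"
    using generate_pow[OF assms] by (auto simp: is_power_of_def)
  then show ?thesis using generate_pow_card[OF assms] by simp
qed

lemma card_powers_ord_dvd:
  assumes "z \<in> carrier G" "d dvd ord z"
  shows "card {w. w \<preceq> z \<and> ord w dvd d} = d"
proof -
  obtain v where v: "v \<preceq> z" "ord v = d" using exists_power_of_order assms by blast
  then have "{w. w \<preceq> z \<and> ord w dvd d} = {w. w \<preceq> v}"
    using power_le_iff_ord_dvd power_le_trans assms(1) by blast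
  then show ?thesis using card_powers power_le_carrier v assms(1) by metis
qed

lemma card_generators:
  assumes "z \<in> carrier G" shows "card {w. w \<preceq> z \<and> ord w = ord z} = totient (ord z)"
proof -
  have "bij_betw (\<lambda>k. z [^] k) (totatives (ord z)) {w. w \<preceq> z \<and> ord w = ord z}"
    unfolding bij_betw_def
  proof
    have "totatives (ord z) \<subseteq> {1..ord z}" by (auto simp: totatives_def)
    then show "inj_on (\<lambda>k. z [^] k) (totatives (ord z))"
      using ord_inj'[OF assms] inj_on_subset by blast
    have n: "ord z > 0" by (rule ord_pos[OF assms])
    have ord_eq: "ord (z [^] k) = ord z \<longleftrightarrow> coprime k (ord z)" if "k > 0" for k :: nat
    proof -
      have "ord (z [^] k) = ord z div gcd (ord z) k" using ord_pow_gen[OF assms] that by simp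
      also have "\<dots> = ord z \<longleftrightarrow> gcd (ord z) k = 1"
        using n div_eq_dividend_iff by auto
      finally show ?thesis by (simp add: coprime_iff_gcd_eq_1 gcd.commute)
    qed
    show "(\<lambda>k. z [^] k) ` totatives (ord z) = {w. w \<preceq> z \<and> ord w = ord z}"
    proof (intro equalityI subsetI)
      fix w assume "w \<in> {w. w \<preceq> z \<and> ord w = ord z}"
      then have w: "w \<preceq> z" "ord w = ord z" by auto
      then obtain i :: int where i: "w = z [^] i" by (auto simp: is_power_of_def)
      define k where "k = (let r = nat (i mod int (ord z)) in if r = 0 then ord z else r)"
      have mod: "i mod int (ord z) \<ge> 0" "i mod int (ord z) < int (ord z)" using n by simp_all
      then have k: "k > 0" "k \<le> ord z"
        using n unfolding k_def Let_def by (auto simp: nat_le_iff intro: less_imp_le)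
      have "int (ord z) dvd i - int k"
      proof (cases "nat (i mod int (ord z)) = 0")
        case True
        then show ?thesis using mod by (simp add: k_def mod_eq_0_iff_dvd)
      next
        case False
        then have "int k = i mod int (ord z)" using mod by (simp add: k_def)
        then show ?thesis by (simp add: dvd_minus_mod)
      qed
      then have wk: "w = z [^] k"
        unfolding i using int_pow_eq[OF assms, of "int k" i] by (simp add: int_pow_int)
      then have "coprime k (ord z)" using ord_eq k w by simp
      then show "w \<in> (\<lambda>k. z [^] k) ` totatives (ord z)"
        using k wk by (auto simp: totatives_def)
    qed (auto simp: totatives_def ord_eq power_le_nat_pow)
  qed
  then show ?thesis unfolding totient_def using bij_betw_same_card by metis
qed

lemma exists_max_ord:
  assumes "P \<subseteq> carrier G" "P \<noteq> {}"
  obtains z where "z \<in> P" "\<And>w. w \<in> P \<Longrightarrow> ord w \<le> ord z"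
proof -
  have "finite P" using assms(1) finite_carrier finite_subset by blast
  then show ?thesis using that Max_in[of "ord ` P"] Max_ge[of "ord ` P"] assms(2) by fastforce
qed

lemma powers_subset_iff:
  assumes "x \<in> carrier G" "y \<in> carrier G"
  shows "{w. w \<preceq> x} \<subseteq> {w. w \<preceq> y} \<longleftrightarrow> x \<preceq> y"
  using power_le_refl power_le_trans assms by blast

lemma cyclic_subgroups_powers: "cyclic_subgroups G = (\<lambda>x. {w. w \<preceq> x}) ` carrier G"
  unfolding cyclic_subgroups_eq[OF is_group] is_power_of_def by (simp add: full_SetCompr_eq)

text \<open>Between two cyclic subgroups it is enough to look for a cyclic intermediate subgroup:
  given \<open>\<langle>x\<rangle> < K < \<langle>y\<rangle>\<close> and \<open>k \<in> K - \<langle>x\<rangle>\<close>, both \<open>x\<close> and \<open>k\<close> are powers of a single element of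
  \<open>K\<close>, by Bezout.\<close>

lemma subgroup_covers_iff:
  assumes "H \<in> cyclic_subgroups G" "H' \<in> cyclic_subgroups G"
  shows "subgroup_covers G H H' \<longleftrightarrow> H \<subset> H' \<and> \<not> (\<exists>K\<in>cyclic_subgroups G. H \<subset> K \<and> K \<subset> H')"
proof -
  obtain x y where x: "x \<in> carrier G" "H = {w. w \<preceq> x}" and y: "y \<in> carrier G" "H' = {w. w \<preceq> y}"
    using assms unfolding cyclic_subgroups_powers by blast
  have "\<exists>K\<in>cyclic_subgroups G. H \<subset> K \<and> K \<subset> H'"
    if K: "subgroup K G" "H \<subset> K" "K \<subset> H'" for K
  proof -
    obtain k where k: "k \<in> K" "\<not> k \<preceq> x" using K x by blast
    have xK: "x \<in> K" using power_le_refl x K(2) by blast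
    obtain i j :: int where ij: "x = y [^] i" "k = y [^] j"
      using K(3) k(1) xK unfolding y(2) is_power_of_def by blast
    define g where "g = gcd i j"
    obtain a b where ab: "a * i + b * j = g" using bezout_int unfolding g_def by blast
    have "y [^] g = x [^] a \<otimes> k [^] b"
      unfolding ij ab[symmetric] using y(1) by (simp add: int_pow_mult int_pow_pow mult.commute)
    also have "\<dots> \<in> K" using K(1) xK k
      by (simp add: subgroup.m_closed group.subgroup_int_pow_closed[OF is_group])
    finally have gK: "y [^] g \<in> K" .
    have gC: "y [^] g \<in> carrier G" using y(1) by simp
    have multiple: "y [^] (g * c) \<preceq> y [^] g" for c
      using y(1) by (auto simp: is_power_of_def simp flip: int_pow_pow)
    have "g dvd i" "g dvd j" by (auto simp: g_def)
    then have le: "x \<preceq> y [^] g" "k \<preceq> y [^] g"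
      unfolding ij using multiple by (metis dvd_def)+
    have "{w. w \<preceq> y [^] g} \<subseteq> K"
      using gK K(1) by (auto simp: is_power_of_def group.subgroup_int_pow_closed[OF is_group])
    moreover have "H \<subset> {w. w \<preceq> y [^] g}"
      unfolding x(2) using powers_subset_iff[OF x(1) gC] le k(2) by blast
    moreover have "{w. w \<preceq> y [^] g} \<in> cyclic_subgroups G"
      using gC unfolding cyclic_subgroups_powers by blast
    moreover have "K \<subset> H'" by (rule K)
    ultimately show ?thesis
      by (meson order.strict_trans1)
  qed
  moreover have "subgroup K G" if "K \<in> cyclic_subgroups G" for K
    using that by (simp add: cyclic_subgroups_def)
  ultimately show ?thesis unfolding subgroup_covers_def
    by meson
qed

end

section \<open>Correspondences that induce isomorphisms of cyclic subgroup graphs\<close>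

locale two_finite_groups = G1: finite_group G1 + G2: finite_group G2
  for G1 :: "('a, 'c) monoid_scheme" and G2 :: "('b, 'd) monoid_scheme"
begin

notation G1.power_le (infix "\<preceq>\<^sub>1" 50) and G2.power_le (infix "\<preceq>\<^sub>2" 50)

text \<open>A correspondence between the elements that preserves and reflects the relation ``is a power
  of'' induces an isomorphism of the posets of cyclic subgroups, and these determine the graphs.\<close>

lemma cyclic_subgroup_graph_iso:
  assumes R: "\<And>x y. R x y \<Longrightarrow> x \<in> carrier G1 \<and> y \<in> carrier G2"
    and tot1: "\<And>x. x \<in> carrier G1 \<Longrightarrow> \<exists>y. R x y"
    and tot2: "\<And>y. y \<in> carrier G2 \<Longrightarrow> \<exists>x. R x y"
    and le: "\<And>x y x' y'. \<lbrakk>R x y; R x' y'\<rbrakk> \<Longrightarrow> x \<preceq>\<^sub>1 x' \<longleftrightarrow> y \<preceq>\<^sub>2 y'"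
  shows "digraph_iso (with_proj (cyclic_subgroup_graph G1)) (with_proj (cyclic_subgroup_graph G2))"
proof -
  \<comment> \<open>The image of \<open>\<langle>x\<rangle>\<close> under the relation is \<open>\<langle>y\<rangle>\<close> for every \<open>y\<close> related to \<open>x\<close>.\<close>
  define F where "F = (\<lambda>H. {w. \<exists>v\<in>H. R v w})"
  have F: "F {v. v \<preceq>\<^sub>1 x} = {w. w \<preceq>\<^sub>2 y}" if "R x y" for x y
  proof -
    have "\<exists>v. v \<preceq>\<^sub>1 x \<and> R v w" if "w \<preceq>\<^sub>2 y" for w
      using tot2[of w] G2.power_le_carrier[OF that] R[OF \<open>R x y\<close>] le[OF _ \<open>R x y\<close>] that by blast
    then show ?thesis
      unfolding F_def using le[OF _ \<open>R x y\<close>] by blast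
  qed
  let ?C1 = "cyclic_subgroups G1" and ?C2 = "cyclic_subgroups G2"
  have rep: "\<exists>x y. R x y \<and> H = {v. v \<preceq>\<^sub>1 x} \<and> F H = {w. w \<preceq>\<^sub>2 y}" if "H \<in> ?C1" for H
    using that F tot1 unfolding G1.cyclic_subgroups_powers by fast
  have sub: "H \<subseteq> H' \<longleftrightarrow> F H \<subseteq> F H'" if "H \<in> ?C1" "H' \<in> ?C1" for H H'
    using rep[OF that(1)] rep[OF that(2)] le R
      G1.powers_subset_iff G2.powers_subset_iff by metis
  have inj: "inj_on F ?C1" using sub by (intro inj_onI) blast
  have im: "F ` ?C1 = ?C2"
  proof (intro equalityI subsetI)
    fix K assume "K \<in> F ` ?C1"
    then show "K \<in> ?C2" using rep R unfolding G2.cyclic_subgroups_powers by fastforce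
  next
    fix K assume "K \<in> ?C2"
    then obtain y where y: "y \<in> carrier G2" "K = {w. w \<preceq>\<^sub>2 y}"
      unfolding G2.cyclic_subgroups_powers by blast
    then obtain x where "R x y" using tot2 by blast
    then show "K \<in> F ` ?C1" using F R y unfolding G1.cyclic_subgroups_powers by blast
  qed
  have psub: "H \<subset> H' \<longleftrightarrow> F H \<subset> F H'" if "H \<in> ?C1" "H' \<in> ?C1" for H H'
    using sub[OF that] sub[OF that(2,1)] by blast
  have cov: "subgroup_covers G1 H H' \<longleftrightarrow> subgroup_covers G2 (F H) (F H')"
    if H: "H \<in> ?C1" "H' \<in> ?C1" for H H'
  proof -
    have "subgroup_covers G1 H H' \<longleftrightarrow> H \<subset> H' \<and> \<not> (\<exists>K\<in>?C1. H \<subset> K \<and> K \<subset> H')"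
      by (rule G1.subgroup_covers_iff[OF H])
    also have "\<dots> \<longleftrightarrow> F H \<subset> F H' \<and> \<not> (\<exists>K\<in>F ` ?C1. F H \<subset> K \<and> K \<subset> F H')"
      using psub H by (simp cong: bex_cong)
    also have "\<dots> \<longleftrightarrow> subgroup_covers G2 (F H) (F H')"
      unfolding im by (rule G2.subgroup_covers_iff[symmetric]) (use H im in auto)
    finally show ?thesis .
  qed
  show ?thesis
    unfolding digraph_iso_with_proj_iff[OF pair_wf_cyclic_subgroup_graph pair_wf_cyclic_subgroup_graph]
  proof (intro exI conjI ballI)
    show "bij_betw F (pverts (cyclic_subgroup_graph G1)) (pverts (cyclic_subgroup_graph G2))"
      using inj im by (simp add: bij_betw_def cyclic_subgroup_graph_def)
    fix H H' assume "H \<in> pverts (cyclic_subgroup_graph G1)" "H' \<in> pverts (cyclic_subgroup_graph G1)"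
    then have H: "H \<in> ?C1" "H' \<in> ?C1" by (simp_all add: cyclic_subgroup_graph_def)
    then have "F H \<in> ?C2" "F H' \<in> ?C2" using im by auto
    moreover have "F H = F H' \<longleftrightarrow> H = H'" using inj_on_eq_iff[OF inj H] .
    ultimately show "(H, H') \<in> parcs (cyclic_subgroup_graph G1) \<longleftrightarrow>
      (F H, F H') \<in> parcs (cyclic_subgroup_graph G2)"
      using H cov[OF H] cov[OF H(2,1)] by (simp add: cyclic_subgroup_graph_def)
  qed
qed

end

section \<open>Cocyclic elements\<close>

text \<open>The shift \<open>q\<close> is the product of the primes dividing \<open>b\<close> but not \<open>c\<close>: a prime divisor of \<open>b\<close> then
  divides exactly one of \<open>c\<close> and \<open>m * q\<close>.\<close>

lemma exists_coprime_shift: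
  fixes b c m :: int
  assumes b: "b \<noteq> 0" and g: "gcd m (gcd b c) = 1"
  shows "\<exists>q. coprime b (c + m * q)"
proof
  define q where "q = \<Prod>{p \<in> prime_factors b. \<not> p dvd c}"
  have fin: "finite {p \<in> prime_factors b. \<not> p dvd c}" by simp
  show "coprime b (c + m * q)"
  proof (rule ccontr)
    assume "\<not> coprime b (c + m * q)"
    then obtain p where p: "prime p" "p dvd b" "p dvd c + m * q"
      using prime_divisor_exists[of "gcd b (c + m * q)"] b by (auto simp: coprime_iff_gcd_eq_1)
    show False
    proof (cases "p dvd c")
      case True
      then have "\<not> p dvd m" using g p(1,2) by (metis gcd_greatest not_prime_unit)
      moreover have "p dvd m * q" using True p(3) by (simp add: dvd_add_right_iff)
      ultimately have "p dvd q" using p(1) prime_dvd_mult_iff by blast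
      then obtain r where "r \<in> prime_factors b" "\<not> r dvd c" "p dvd r"
        using prime_dvd_prod_iff[OF fin p(1), of "\<lambda>x. x"] unfolding q_def by auto
      then show False using True p(1) by (metis in_prime_factors_imp_prime primes_dvd_imp_eq)
    next
      case False
      then have "p dvd q" unfolding q_def using p b dvd_prodI[OF fin, of p "\<lambda>x. x"]
        by (simp add: in_prime_factors_iff)
      then show False using False p(3) by (simp add: dvd_add_left_iff)
    qed
  qed
qed

context finite_group
begin

lemma power_le_int_pow: "x [^] (i::int) \<preceq> x"
  by (auto simp: is_power_of_def)

lemma commutes_int_pow:
  assumes "x \<otimes> y = y \<otimes> x" "x \<in> carrier G" "y \<in> carrier G"
  shows "x [^] (i::int) \<otimes> y = y \<otimes> x [^] i"
  using assms group_commutes_pow[of x y] power_le_int_pow[of x i] power_le_iff_nat_pow by metis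

lemma commutes_int_pows:
  assumes "x \<otimes> y = y \<otimes> x" "x \<in> carrier G" "y \<in> carrier G"
  shows "x [^] (i::int) \<otimes> y [^] (j::int) = y [^] j \<otimes> x [^] i"
  using commutes_int_pow[of y "x [^] i" j] commutes_int_pow[OF assms, of i] assms by simp

text \<open>The generators \<open>z\<close> and \<open>w\<close> of an abelian group subject to \<open>w\<^sup>b = z\<^sup>c\<close> may be replaced by a single
  one if \<open>b\<close> is coprime to \<open>c\<close>. The exponent \<open>c\<close> matters only modulo the order of \<open>z\<close>, so the weaker
  hypothesis suffices.\<close>

lemma exists_common_root:
  assumes z: "z \<in> carrier G" and w: "w \<in> carrier G" and comm: "z \<otimes> w = w \<otimes> z"
    and eq: "w [^] b = z [^] c" and b: "b \<noteq> 0" and g: "gcd (ord z) (gcd b c) = 1"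
  shows "\<exists>u\<in>carrier G. z \<preceq> u \<and> w \<preceq> u"
proof -
  define m where "m = int (ord z)"
  have "gcd m (gcd (int b) (int c)) = 1" using g unfolding m_def by (metis gcd_int_int_eq int_ops(2))
  then obtain q where q: "coprime (int b) (int c + m * q)"
    using exists_coprime_shift[of "int b" m "int c"] b by auto
  define d where "d = int c + m * q"
  obtain s t where st: "s * d + t * int b = 1" 
    using q bezout_int[of d "int b"] unfolding d_def by (metis coprime_iff_gcd_eq_1 coprime_commute)
  have zd: "z [^] d = w [^] int b"
    using int_pow_eq[OF z, of d "int c"] eq by (simp add: d_def m_def int_pow_int)
  let ?u = "z [^] t \<otimes> w [^] s"
  have pow: "?u [^] i = z [^] (t * i) \<otimes> w [^] (s * i)" for i :: int
    using int_pow_mult_distrib[OF commutes_int_pows[OF comm z w, of t s]] z w by (simp add: int_pow_pow)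
  have "w [^] (s * int b) = z [^] (s * d)"
    using zd z w by (metis int_pow_pow mult.commute)
  then have "?u [^] int b = z [^] (t * int b + s * d)"
    unfolding pow using z by (simp add: int_pow_mult)
  then have zu: "?u [^] int b = z" using st z by (simp add: add.commute)
  have "z [^] (t * d) = w [^] (t * int b)"
    using zd z w by (metis int_pow_pow mult.commute)
  then have "?u [^] d = w [^] (t * int b + s * d)"
    unfolding pow using w by (simp add: int_pow_mult)
  then have wu: "?u [^] d = w" using st w by (simp add: add.commute)
  show ?thesis using z w zu wu unfolding is_power_of_def by (intro bexI[of _ ?u]) (metis, simp)
qed

text \<open>Two elements of a cyclic group generate a cyclic subgroup, and its generator is a product of powers
  of the two elements.\<close>

lemma exists_join:
  assumes "x \<preceq> z" "y \<preceq> z" and z: "z \<in> carrier G"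
  obtains r i j where "r \<preceq> z" "x \<preceq> r" "y \<preceq> r" "r = x [^] (i::int) \<otimes> y [^] (j::int)"
proof -
  obtain a b :: int where ab: "x = z [^] a" "y = z [^] b"
    using assms by (auto simp: is_power_of_def)
  obtain i j where ij: "i * a + j * b = gcd a b" using bezout_int by blast
  have multiple: "z [^] (gcd a b * c) \<preceq> z [^] gcd a b" for c
    using z by (auto simp: is_power_of_def simp flip: int_pow_pow)
  show ?thesis
  proof
    show "z [^] gcd a b \<preceq> z" by (auto simp: is_power_of_def)
    show "x \<preceq> z [^] gcd a b" "y \<preceq> z [^] gcd a b"
      unfolding ab using multiple by (metis dvd_def gcd_dvd1, metis dvd_def gcd_dvd2)
    show "z [^] gcd a b = x [^] i \<otimes> y [^] j"
      unfolding ab ij[symmetric] using z by (simp add: int_pow_mult int_pow_pow mult.commute)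
  qed
qed

lemma product_of_powers_le:
  assumes "x \<preceq> z" "y \<preceq> z" "z \<in> carrier G"
  shows "x [^] (i::int) \<otimes> y [^] (j::int) \<preceq> z"
proof (intro power_le_mult)
  show "x [^] i \<preceq> z" "y [^] j \<preceq> z"
    using assms power_le_trans unfolding is_power_of_def by (metis int_pow_pow)+
qed (fact assms)

text \<open>Two elements are cocyclic if a cyclic subgroup contains both; this is adjacency or equality in the
  enhanced power graph.\<close>

definition cocyclic :: "'a \<Rightarrow> 'a \<Rightarrow> bool" where
  "cocyclic x y \<longleftrightarrow> (\<exists>z\<in>carrier G. x \<preceq> z \<and> y \<preceq> z)"

text \<open>The main step towards cliques: if \<open>r\<close> generates \<open>\<langle>x, y\<rangle>\<close>, then an element \<open>w\<close> cocyclic with \<open>x\<close> and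
  with \<open>y\<close> is cocyclic with \<open>r\<close>. The reason is that \<open>\<langle>r\<rangle> \<inter> \<langle>w\<rangle>\<close> is as large as the orders allow: it
  contains the subgroups of \<open>\<langle>w\<rangle>\<close> of orders \<open>gcd (ord x) (ord w)\<close> and \<open>gcd (ord y) (ord w)\<close>, and the
  least common multiple of these numbers is \<open>gcd (ord r) (ord w)\<close>, by distributivity.\<close>

lemma cocyclic_join:
  assumes xw: "cocyclic x w" and yw: "cocyclic y w"
    and r: "r \<in> carrier G" "x \<preceq> r" "y \<preceq> r" "r = x [^] (i::int) \<otimes> y [^] (j::int)"
  shows "cocyclic r w"
proof -
  obtain z1 where z1: "z1 \<in> carrier G" "x \<preceq> z1" "w \<preceq> z1" using xw by (auto simp: cocyclic_def)
  obtain z2 where z2: "z2 \<in> carrier G" "y \<preceq> z2" "w \<preceq> z2" using yw by (auto simp: cocyclic_def)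
  have C: "x \<in> carrier G" "y \<in> carrier G" "w \<in> carrier G" using power_le_carrier z1 z2 by blast+
  define m n where "m = ord r" and "n = ord w"
  have mn: "m > 0" "n > 0" using ord_pos r C by (auto simp: m_def n_def)
  have xy: "x \<otimes> y = y \<otimes> x" using power_le_commute r by blast
  have comm: "r \<otimes> w = w \<otimes> r"
  proof -
    have "w \<otimes> x = x \<otimes> w" "w \<otimes> y = y \<otimes> w" using power_le_commute z1 z2 by metis+
    then have "x [^] i \<otimes> w = w \<otimes> x [^] i" "y [^] j \<otimes> w = w \<otimes> y [^] j"
      using C commutes_int_pow by metis+
    then show ?thesis unfolding r(4) using C by (metis int_pow_closed m_assoc)
  qed
  have m_dvd: "m dvd lcm (ord x) (ord y)"
  proof -
    let ?l = "int (lcm (ord x) (ord y))"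
    have "r [^] ?l = (x [^] i) [^] ?l \<otimes> (y [^] j) [^] ?l"
      unfolding r(4) using C by (intro int_pow_mult_distrib commutes_int_pows xy) auto
    also have "\<dots> = \<one>"
    proof -
      have "(x [^] i) [^] ?l = \<one>" "(y [^] j) [^] ?l = \<one>"
        using C by (auto simp: int_pow_pow int_pow_eq_id)
      then show ?thesis by simp
    qed
    finally show ?thesis using int_pow_eq_id[OF r(1)] unfolding m_def by simp
  qed
  obtain v1 where v1: "v1 \<preceq> w" "ord v1 = gcd (ord x) n"
    using exists_power_of_order[of w "gcd (ord x) n"] C by (auto simp: n_def)
  obtain v2 where v2: "v2 \<preceq> w" "ord v2 = gcd (ord y) n"
    using exists_power_of_order[of w "gcd (ord y) n"] C by (auto simp: n_def)
  have "v1 \<preceq> x" using power_le_iff_ord_dvd[of v1 z1 x] power_le_trans[OF v1(1) z1(3)] z1 v1 by simp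
  then have v1r: "v1 \<preceq> r" using power_le_trans r by blast
  have "v2 \<preceq> y" using power_le_iff_ord_dvd[of v2 z2 y] power_le_trans[OF v2(1) z2(3)] z2 v2 by simp
  then have v2r: "v2 \<preceq> r" using power_le_trans r by blast
  obtain s k l where s: "s \<preceq> w" "v1 \<preceq> s" "v2 \<preceq> s" "s = v1 [^] (k::int) \<otimes> v2 [^] (l::int)"
    using exists_join[OF v1(1) v2(1) C(3)] by blast
  have sr: "s \<preceq> r" using product_of_powers_le[OF v1r v2r r(1)] s(4) by simp
  have sC: "s \<in> carrier G" using power_le_carrier s C by blast
  have "gcd m n dvd gcd (lcm (ord x) (ord y)) n" using m_dvd by (simp add: dvd_trans[OF _ m_dvd])
  also have "\<dots> = lcm (gcd (ord x) n) (gcd (ord y) n)" by (simp add: gcd.commute[of _ n] gcd_lcm_distrib)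
  also have "\<dots> dvd ord s" using power_le_ord_dvd[OF s(2) sC] power_le_ord_dvd[OF s(3) sC] v1 v2 by simp
  finally have dvd_s: "gcd m n dvd ord s" .
  \<comment> \<open>The power \<open>w [^] b\<close> generates the subgroup of \<open>\<langle>w\<rangle>\<close> of order \<open>gcd m n\<close>.\<close>
  define b where "b = n div gcd m n"
  have bn: "b * gcd m n = n" by (simp add: b_def)
  then have b: "b dvd n" "b > 0" using mn by (metis dvd_triv_left, metis mult_is_0 gr0I less_numeral_extra(3))
  have ord_wb: "ord (w [^] b) = gcd m n"
    using ord_pow[OF C(3), of b] b bn unfolding n_def[symmetric] by (metis nonzero_mult_div_cancel_left less_numeral_extra(3))
  then have "w [^] b \<preceq> s"
    using power_le_iff_ord_dvd[OF power_le_nat_pow s(1) C(3)] dvd_s by simp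
  then have "w [^] b \<preceq> r" using sr power_le_trans r by blast
  then obtain c where c: "w [^] b = r [^] (c::nat)" using r(1) power_le_iff_nat_pow by blast
  have "gcd m n = m div gcd m c"
    using ord_wb ord_pow_gen[OF r(1), of c] mn unfolding c m_def by (cases "c = 0") auto
  then have "m = gcd m n * gcd m c" by (simp add: dvd_div_mult_self)
  moreover have "m = gcd m n * (m div gcd m n)" by simp
  ultimately have "gcd m c = m div gcd m n" using mn by (metis mult_cancel1 gcd_eq_0_iff less_numeral_extra(3))
  then have "coprime (gcd m c) b" using mn div_gcd_coprime[of m n] by (simp add: b_def)
  then have "gcd m (gcd b c) = 1"
    by (metis coprime_iff_gcd_eq_1 gcd.assoc gcd.commute)
  then show ?thesis
    using exists_common_root[OF r(1) C(3) comm c] b unfolding cocyclic_def m_def by simp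
qed

lemma pairwise_cocyclic_imp_cyclic:
  assumes "S \<subseteq> carrier G" and S: "\<And>x y. x \<in> S \<Longrightarrow> y \<in> S \<Longrightarrow> cocyclic x y"
  obtains z where "z \<in> carrier G" "\<And>x. x \<in> S \<Longrightarrow> x \<preceq> z"
proof -
  \<comment> \<open>Among the elements cocyclic with all of \<open>S\<close>, one of largest order absorbs every \<open>x \<in> S\<close>.\<close>
  let ?P = "{z \<in> carrier G. \<forall>x\<in>S. cocyclic z x}"
  have "\<one> \<in> ?P" using assms(1) one_power_le power_le_refl unfolding cocyclic_def by blast
  moreover have "?P \<subseteq> carrier G" by blast
  ultimately obtain z where z: "z \<in> ?P" and max: "\<And>w. w \<in> ?P \<Longrightarrow> ord w \<le> ord z"
    using exists_max_ord[of ?P] by blast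
  show ?thesis
  proof
    show "z \<in> carrier G" using z by simp
    fix x assume x: "x \<in> S"
    then obtain t where t: "t \<in> carrier G" "z \<preceq> t" "x \<preceq> t" using z by (auto simp: cocyclic_def)
    obtain r i j where r: "r \<preceq> t" "z \<preceq> r" "x \<preceq> r" "r = z [^] (i::int) \<otimes> x [^] (j::int)"
      using exists_join[OF t(2,3,1)] by blast
    have rC: "r \<in> carrier G" using power_le_carrier r t by blast
    have "cocyclic r w" if "w \<in> S" for w
      using cocyclic_join[OF _ _ rC r(2-4)] z S x that by blast
    then have "ord r \<le> ord z" using max rC by simp
    then have "r \<preceq> z" using power_le_ord_antisym r(2) rC by blast
    then show "x \<preceq> z" using power_le_trans r(3) z by blast
  qed
qed

text \<open>The intersection of two cyclic subgroups is cyclic.\<close>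

lemma exists_meet:
  assumes "z \<in> carrier G" "z' \<in> carrier G"
  obtains c where "c \<in> carrier G" "{w. w \<preceq> z} \<inter> {w. w \<preceq> z'} = {w. w \<preceq> c}"
proof -
  let ?P = "{w. w \<preceq> z} \<inter> {w. w \<preceq> z'}"
  have P: "?P \<subseteq> carrier G" using power_le_carrier assms by blast
  have coc: "cocyclic x y" if "x \<in> ?P" "y \<in> ?P" for x y
    using that assms unfolding cocyclic_def by blast
  have "\<one> \<in> ?P" using one_power_le by simp
  then obtain c where c: "c \<in> ?P" and max: "\<And>w. w \<in> ?P \<Longrightarrow> ord w \<le> ord c"
    using exists_max_ord[OF P] by blast
  have cC: "c \<in> carrier G" using c P by blast
  have "w \<preceq> c" if w: "w \<in> ?P" for w
  proof -
    obtain r i j where r: "r \<preceq> z" "w \<preceq> r" "c \<preceq> r" "r = w [^] (i::int) \<otimes> c [^] (j::int)"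
      using exists_join[of w z c] w c assms by blast
    then have "r \<preceq> z'" using product_of_powers_le[of w z' c] w c assms by simp
    then have "ord r \<le> ord c" using max r by simp
    moreover have "r \<in> carrier G" using power_le_carrier r assms by blast
    ultimately have "r \<preceq> c" using power_le_ord_antisym r(3) by blast
    then show ?thesis using power_le_trans r cC by blast
  qed
  moreover have "w \<in> ?P" if "w \<preceq> c" for w using that c power_le_trans assms by blast
  ultimately have "?P = {w. w \<preceq> c}" by blast
  then show ?thesis using that cC by blast
qed

text \<open>The inclusion-maximal sets of pairwise cocyclic elements, that is, the maximal cliques of the
  enhanced power graph. The equivalence states both that \<open>M\<close> is such a set (\<open>N = M\<close>) and that no
  other such set contains it.\<close>

definition max_cocyclic :: "'a set \<Rightarrow> bool" where
  "max_cocyclic M \<longleftrightarrow> (\<forall>N. M \<subseteq> N \<and> N \<subseteq> carrier G \<and> (\<forall>x\<in>N. \<forall>y\<in>N. cocyclic x y) \<longleftrightarrow> N = M)"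

lemma max_cocyclic_cyclic:
  assumes "max_cocyclic M"
  obtains z where "z \<in> carrier G" "M = {w. w \<preceq> z}"
proof -
  have M: "M \<subseteq> carrier G" "\<And>x y. x \<in> M \<Longrightarrow> y \<in> M \<Longrightarrow> cocyclic x y"
    using assms unfolding max_cocyclic_def by blast+
  obtain z where z: "z \<in> carrier G" "\<And>x. x \<in> M \<Longrightarrow> x \<preceq> z"
    using pairwise_cocyclic_imp_cyclic[OF M] by blast
  then have "M \<subseteq> {w. w \<preceq> z} \<and> {w. w \<preceq> z} \<subseteq> carrier G \<and> (\<forall>x\<in>{w. w \<preceq> z}. \<forall>y\<in>{w. w \<preceq> z}. cocyclic x y)"
    using power_le_carrier unfolding cocyclic_def by blast
  then have "{w. w \<preceq> z} = M" using assms[unfolded max_cocyclic_def, THEN spec, of "{w. w \<preceq> z}"] by simp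
  then show ?thesis using that z by blast
qed

lemma exists_max_cocyclic:
  assumes x: "x \<in> carrier G"
  obtains M where "max_cocyclic M" "x \<in> M"
proof -
  let ?P = "{z \<in> carrier G. x \<preceq> z}"
  have "x \<in> ?P" using x power_le_refl by simp
  moreover have "?P \<subseteq> carrier G" by blast
  ultimately obtain z where z: "z \<in> ?P" and max: "\<And>w. w \<in> ?P \<Longrightarrow> ord w \<le> ord z"
    using exists_max_ord[of ?P] by blast
  have "max_cocyclic {w. w \<preceq> z}"
    unfolding max_cocyclic_def
  proof (intro allI iffI)
    fix N assume N: "{w. w \<preceq> z} \<subseteq> N \<and> N \<subseteq> carrier G \<and> (\<forall>x\<in>N. \<forall>y\<in>N. cocyclic x y)"
    then obtain t where t: "t \<in> carrier G" "\<And>x. x \<in> N \<Longrightarrow> x \<preceq> t"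
      using pairwise_cocyclic_imp_cyclic[of N] by blast
    have zt: "z \<preceq> t" using t N power_le_refl z by blast
    then have "ord t \<le> ord z" using max power_le_trans z t by blast
    then have "t \<preceq> z" using power_le_ord_antisym zt t by blast
    then show "N = {w. w \<preceq> z}" using N t power_le_trans z by blast
  next
    fix N assume "N = {w. w \<preceq> z}"
    then show "{w. w \<preceq> z} \<subseteq> N \<and> N \<subseteq> carrier G \<and> (\<forall>x\<in>N. \<forall>y\<in>N. cocyclic x y)"
      using power_le_carrier z unfolding cocyclic_def by blast
  qed
  then show ?thesis using that z by blast
qed

end

section \<open>The enhanced power graph\<close>

context finite_group
begin

lemma adj_enhanced_power_graph:
  assumes "x \<in> carrier G" "y \<in> carrier G"
  shows "(x, y) \<in> parcs (enhanced_power_graph G) \<or> x = y \<longleftrightarrow> cocyclic x y"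
  using assms power_le_refl unfolding cocyclic_def enhanced_power_graph_def by auto

end

context two_finite_groups
begin

lemma swap: "two_finite_groups G2 G1"
  by unfold_locales

text \<open>Let cyclic subgroups \<open>\<langle>z\<rangle>\<close>, \<open>\<langle>z'\<rangle>\<close> of one group and \<open>\<langle>t\<rangle>\<close>, \<open>\<langle>t'\<rangle>\<close> of the other meet in subgroups of the
  same order. Then elements of equal orders in corresponding cyclic subgroups are related alike: as
  \<open>x\<close> lies in the first intersection, the order of \<open>y\<close> divides that of the second, which therefore
  contains \<open>y\<close>.\<close>

lemma power_le_transfer:
  assumes z: "z \<in> carrier G1" "z' \<in> carrier G1" and t: "t \<in> carrier G2" "t' \<in> carrier G2"
    and le: "x \<preceq>\<^sub>1 z" "x' \<preceq>\<^sub>1 z'" "y \<preceq>\<^sub>2 t" "y' \<preceq>\<^sub>2 t'"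
    and card: "card ({v. v \<preceq>\<^sub>1 z} \<inter> {v. v \<preceq>\<^sub>1 z'}) = card ({w. w \<preceq>\<^sub>2 t} \<inter> {w. w \<preceq>\<^sub>2 t'})"
    and ord: "G1.ord x = G2.ord y" "G1.ord x' = G2.ord y'"
    and xx': "x \<preceq>\<^sub>1 x'"
  shows "y \<preceq>\<^sub>2 y'"
proof -
  obtain c where c: "c \<in> carrier G1" "{v. v \<preceq>\<^sub>1 z} \<inter> {v. v \<preceq>\<^sub>1 z'} = {v. v \<preceq>\<^sub>1 c}"
    using G1.exists_meet z by blast
  obtain d where d: "d \<in> carrier G2" "{w. w \<preceq>\<^sub>2 t} \<inter> {w. w \<preceq>\<^sub>2 t'} = {w. w \<preceq>\<^sub>2 d}"
    using G2.exists_meet t by blast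
  have cd: "G1.ord c = G2.ord d"
    using card G1.card_powers[OF c(1)] G2.card_powers[OF d(1)] unfolding c(2) d(2) by simp
  have d_le: "d \<preceq>\<^sub>2 t" "d \<preceq>\<^sub>2 t'" using G2.power_le_refl[OF d(1)] d(2) by blast+
  have "x \<preceq>\<^sub>1 c" using c(2) le(1) G1.power_le_trans[OF xx' le(2) z(2)] by blast
  then have "G2.ord y dvd G2.ord d" using G1.power_le_ord_dvd c(1) ord(1) cd by metis
  then have "y \<preceq>\<^sub>2 d" using G2.power_le_iff_ord_dvd[OF le(3) d_le(1) t(1)] by simp
  then have "y \<preceq>\<^sub>2 t'" using G2.power_le_trans d_le(2) t(2) by blast
  moreover have "x' \<in> carrier G1" using G1.power_le_carrier le(2) z(2) by blast
  then have "G2.ord y dvd G2.ord y'" using G1.power_le_ord_dvd[OF xx'] ord by simp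
  ultimately show ?thesis using G2.power_le_iff_ord_dvd[OF _ le(4) t(2)] by simp
qed

lemma max_cocyclic_image:
  assumes bij: "bij_betw f (carrier G1) (carrier G2)"
    and coc: "\<And>x y. x \<in> carrier G1 \<Longrightarrow> y \<in> carrier G1 \<Longrightarrow> G1.cocyclic x y \<longleftrightarrow> G2.cocyclic (f x) (f y)"
    and M: "G1.max_cocyclic M"
  shows "G2.max_cocyclic (f ` M)"
proof -
  have MC: "M \<subseteq> carrier G1" using M G1.max_cocyclic_cyclic G1.power_le_carrier by blast
  have iff: "f ` M \<subseteq> f ` N \<and> f ` N \<subseteq> carrier G2 \<and> (\<forall>x\<in>f ` N. \<forall>y\<in>f ` N. G2.cocyclic x y) \<longleftrightarrow> f ` N = f ` M"
    if N: "N \<subseteq> carrier G1" for N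
  proof -
    have inj: "inj_on f (carrier G1)" using bij by (simp add: bij_betw_def)
    have "f x \<in> f ` N \<longleftrightarrow> x \<in> N" if "x \<in> M" for x
      using inj_on_image_mem_iff[OF inj] that MC N by blast
    then have "f ` M \<subseteq> f ` N \<longleftrightarrow> M \<subseteq> N" by blast
    moreover have "f ` N = f ` M \<longleftrightarrow> N = M"
      by (rule inj_on_image_eq_iff[OF inj N MC])
    moreover have "f ` N \<subseteq> carrier G2" using bij N by (auto simp: bij_betw_def)
    moreover have "(\<forall>x\<in>f ` N. \<forall>y\<in>f ` N. G2.cocyclic x y) \<longleftrightarrow> (\<forall>x\<in>N. \<forall>y\<in>N. G1.cocyclic x y)"
      using coc N by blast
    ultimately show ?thesis using M[unfolded G1.max_cocyclic_def, THEN spec, of N] N by simp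
  qed
  show ?thesis unfolding G2.max_cocyclic_def
  proof
    fix K
    show "f ` M \<subseteq> K \<and> K \<subseteq> carrier G2 \<and> (\<forall>x\<in>K. \<forall>y\<in>K. G2.cocyclic x y) \<longleftrightarrow> K = f ` M"
    proof (cases "K \<subseteq> carrier G2")
      case True
      then obtain N where N: "N \<subseteq> carrier G1" "K = f ` N"
        using bij by (metis bij_betw_imp_surj_on subset_imageE)
      show ?thesis unfolding N(2) by (rule iff[OF N(1)])
    next
      case False
      moreover have "f ` M \<subseteq> carrier G2" using MC bij by (auto simp: bij_betw_def)
      ultimately show ?thesis by blast
    qed
  qed
qed

lemma enhanced_power_graph_determines:
  assumes "digraph_iso (with_proj (enhanced_power_graph G1)) (with_proj (enhanced_power_graph G2))"
  shows "digraph_iso (with_proj (cyclic_subgroup_graph G1)) (with_proj (cyclic_subgroup_graph G2))"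
proof -
  obtain f where bij: "bij_betw f (carrier G1) (carrier G2)"
    and adj: "\<And>x y. x \<in> carrier G1 \<Longrightarrow> y \<in> carrier G1 \<Longrightarrow>
      (x, y) \<in> parcs (enhanced_power_graph G1) \<longleftrightarrow> (f x, f y) \<in> parcs (enhanced_power_graph G2)"
    using assms unfolding digraph_iso_with_proj_iff[OF pair_wf_enhanced_power_graph pair_wf_enhanced_power_graph]
    by (auto simp: enhanced_power_graph_def)
  have coc: "G1.cocyclic x y \<longleftrightarrow> G2.cocyclic (f x) (f y)"
    if "x \<in> carrier G1" "y \<in> carrier G1" for x y
    using G1.adj_enhanced_power_graph[OF that] G2.adj_enhanced_power_graph[of "f x" "f y"] adj[OF that]
      bij that by (metis bij_betw_apply bij_betw_imp_inj_on inj_onD)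
  define R where "R = (\<lambda>x y. G1.ord x = G2.ord y \<and> (\<exists>M. G1.max_cocyclic M \<and> x \<in> M \<and> y \<in> f ` M))"
  have gens: "\<exists>z t. z \<in> carrier G1 \<and> t \<in> carrier G2 \<and> M = {v. v \<preceq>\<^sub>1 z} \<and> f ` M = {w. w \<preceq>\<^sub>2 t}"
    if "G1.max_cocyclic M" for M
    using G1.max_cocyclic_cyclic[OF that] G2.max_cocyclic_cyclic[OF max_cocyclic_image[OF bij coc that]] by metis
  have card_image_M: "card (f ` M) = card M" if "M \<subseteq> carrier G1" for M
    using bij that by (metis bij_betw_def card_image inj_on_subset)
  have ord_eq: "G1.ord z = G2.ord t"
    if "z \<in> carrier G1" "t \<in> carrier G2" "M = {v. v \<preceq>\<^sub>1 z}" "f ` M = {w. w \<preceq>\<^sub>2 t}" for M z t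
  proof -
    have "M \<subseteq> carrier G1" using that G1.power_le_carrier by blast
    then show ?thesis
      using card_image_M that G1.card_powers[of z] G2.card_powers[of t] by metis
  qed
  show ?thesis
  proof (rule cyclic_subgroup_graph_iso[of R])
    show "x \<in> carrier G1 \<and> y \<in> carrier G2" if "R x y" for x y
      using that gens G1.power_le_carrier G2.power_le_carrier unfolding R_def by blast
    show "\<exists>y. R x y" if x: "x \<in> carrier G1" for x
    proof -
      obtain M where M: "G1.max_cocyclic M" "x \<in> M" using G1.exists_max_cocyclic x by blast
      then obtain z t where zt: "z \<in> carrier G1" "t \<in> carrier G2" "M = {v. v \<preceq>\<^sub>1 z}" "f ` M = {w. w \<preceq>\<^sub>2 t}"
        using gens by blast
      have "x \<preceq>\<^sub>1 z" using M(2) zt(3) by blast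
      then have "G1.ord x dvd G2.ord t"
        using ord_eq[OF zt] G1.power_le_ord_dvd zt(1) by metis
      then obtain y where "y \<preceq>\<^sub>2 t" "G2.ord y = G1.ord x" using G2.exists_power_of_order zt(2) by blast
      then have "G1.ord x = G2.ord y" "y \<in> f ` M" using zt(4) by simp_all
      then show ?thesis unfolding R_def using M by blast
    qed
    show "\<exists>x. R x y" if y: "y \<in> carrier G2" for y
    proof -
      obtain x0 where x0: "x0 \<in> carrier G1" "y = f x0" using y bij by (auto simp: bij_betw_def)
      obtain M where M: "G1.max_cocyclic M" "x0 \<in> M" using G1.exists_max_cocyclic x0 by blast
      then obtain z t where zt: "z \<in> carrier G1" "t \<in> carrier G2" "M = {v. v \<preceq>\<^sub>1 z}" "f ` M = {w. w \<preceq>\<^sub>2 t}"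
        using gens by blast
      have "y \<preceq>\<^sub>2 t" using M(2) zt(4) x0 by blast
      then have "G2.ord y dvd G1.ord z"
        using ord_eq[OF zt] G2.power_le_ord_dvd zt(2) by metis
      then obtain x where "x \<preceq>\<^sub>1 z" "G1.ord x = G2.ord y" using G1.exists_power_of_order zt(1) by blast
      then have "G1.ord x = G2.ord y" "x \<in> M" "y \<in> f ` M" using zt(3,4) \<open>y \<preceq>\<^sub>2 t\<close> by simp_all
      then show ?thesis unfolding R_def using M(1) by blast
    qed
    fix x y x' y' assume xy: "R x y" and xy': "R x' y'"
    obtain M where M: "G1.max_cocyclic M" "x \<in> M" "y \<in> f ` M" using xy unfolding R_def by blast
    obtain M' where M': "G1.max_cocyclic M'" "x' \<in> M'" "y' \<in> f ` M'" using xy' unfolding R_def by blast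
    obtain z t where zt: "z \<in> carrier G1" "t \<in> carrier G2" "M = {v. v \<preceq>\<^sub>1 z}" "f ` M = {w. w \<preceq>\<^sub>2 t}"
      using gens M by blast
    obtain z' t' where zt': "z' \<in> carrier G1" "t' \<in> carrier G2" "M' = {v. v \<preceq>\<^sub>1 z'}" "f ` M' = {w. w \<preceq>\<^sub>2 t'}"
      using gens M' by blast
    have le: "x \<preceq>\<^sub>1 z" "x' \<preceq>\<^sub>1 z'" "y \<preceq>\<^sub>2 t" "y' \<preceq>\<^sub>2 t'" using M M' zt zt' by blast+
    have MC: "M \<subseteq> carrier G1" "M' \<subseteq> carrier G1"
      unfolding zt(3) zt'(3) using G1.power_le_carrier zt(1) zt'(1) by blast+
    then have "f ` M \<inter> f ` M' = f ` (M \<inter> M')" using bij inj_on_image_Int[of f "carrier G1" M M']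
      by (simp add: bij_betw_def)
    then have "card (M \<inter> M') = card (f ` M \<inter> f ` M')"
      using card_image_M[of "M \<inter> M'"] MC by (metis le_infI1)
    then have card: "card ({v. v \<preceq>\<^sub>1 z} \<inter> {v. v \<preceq>\<^sub>1 z'}) = card ({w. w \<preceq>\<^sub>2 t} \<inter> {w. w \<preceq>\<^sub>2 t'})"
      unfolding zt(4) zt'(4) unfolding zt(3) zt'(3) .
    have ord: "G1.ord x = G2.ord y" "G1.ord x' = G2.ord y'" using xy xy' by (auto simp: R_def)
    show "x \<preceq>\<^sub>1 x' \<longleftrightarrow> y \<preceq>\<^sub>2 y'"
      using power_le_transfer[OF zt(1) zt'(1) zt(2) zt'(2) le card ord]
        two_finite_groups.power_le_transfer[OF swap zt(2) zt'(2) zt(1) zt'(1) le(3,4,1,2) card[symmetric] ord[symmetric]]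
      by blast
  qed
qed

end

section \<open>Divisors and totients\<close>

lemma prime_power_if_unique_prime:
  fixes n p :: nat
  assumes n: "n > 0" and p: "prime p" and uniq: "\<And>q. prime q \<Longrightarrow> q dvd n \<Longrightarrow> q = p"
  shows "\<exists>k. n = p ^ k"
proof -
  obtain m where m: "n = p ^ multiplicity p n * m" "\<not> p dvd m"
    using multiplicity_decompose'[of n p] n p by (metis gr_implies_not0 not_prime_unit)
  have "m = 1"
  proof (rule ccontr)
    assume "m \<noteq> 1"
    then obtain q where "prime q" "q dvd m" using prime_factor_nat by blast
    then show False using uniq m by (metis dvd_mult)
  qed
  then show ?thesis using m(1) by auto
qed

text \<open>Take a prime \<open>p\<close> dividing \<open>n div m\<close>. Then the full power of \<open>p\<close> in \<open>n\<close> does not divide \<open>m\<close>, so \<open>m\<close>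
  divides it and is a power of \<open>p\<close>; no other prime divisor of \<open>n\<close> divides \<open>m\<close> or is divisible by it.\<close>

lemma prime_power_if_comparable_divisor:
  fixes m n :: nat
  assumes "m dvd n" "1 < m" "m < n" and comp: "\<And>d. d dvd n \<Longrightarrow> d dvd m \<or> m dvd d"
  shows "\<exists>p k. prime p \<and> n = p ^ k"
proof -
  have n: "n > 0" using assms by simp
  obtain l where l: "n = m * l" using assms(1) by blast
  then have "l \<noteq> 1" using assms by simp
  then obtain p where p: "prime p" "p dvd l" using prime_factor_nat by blast
  define a where "a = multiplicity p n"
  have "\<not> p ^ a dvd m"
  proof
    assume "p ^ a dvd m"
    then have "p ^ Suc a dvd n" using p(2) unfolding l power_Suc by (metis mult.commute mult_dvd_mono)
    moreover have "\<not> is_unit p" using p(1) not_prime_unit by blast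
    ultimately show False using n power_dvd_iff_le_multiplicity[of n p "Suc a"]
      by (simp add: a_def)
  qed
  then have "m dvd p ^ a" using comp[of "p ^ a"] by (auto simp: a_def multiplicity_dvd)
  then obtain b where b: "m = p ^ b" using divides_primepow_nat[OF p(1)] by blast
  then have pm: "p dvd m" using assms(2) by (cases b) auto
  have "q = p" if q: "prime q" "q dvd n" for q
  proof -
    have "q dvd m \<or> m dvd q" using comp q by blast
    then show ?thesis
    proof
      assume "q dvd m"
      then show ?thesis using b q p(1) prime_dvd_power primes_dvd_imp_eq by metis
    next
      assume "m dvd q"
      then show ?thesis using pm q p(1) primes_dvd_imp_eq dvd_trans by metis
    qed
  qed
  then show ?thesis using prime_power_if_unique_prime[OF n p(1)] p(1) by blast
qed

text \<open>Multiplying \<open>e\<close> by a prime \<open>q\<close> multiplies the totient by \<open>q\<close> or, if \<open>q\<close> does not divide \<open>e\<close>, by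
  \<open>q - 1\<close>; so the totient is unchanged only for \<open>q = 2\<close> and odd \<open>e\<close>.\<close>

lemma totient_dvd_eq_cases:
  fixes d n :: nat
  assumes "d dvd n" "n > 0" and eq: "totient d = totient n"
  shows "n = d \<or> n = 2 * d \<and> odd d"
proof -
  have step: "q = 2 \<and> odd e" if q: "prime q" and dvd: "e * q dvd n" "d dvd e" for q e
  proof -
    have "e > 0" using dvd(1) assms(2) by (cases e) auto
    then have e: "totient e > 0" by simp
    have "totient d \<le> totient e" "totient e \<le> totient (e * q)" "totient (e * q) \<le> totient n"
      using dvd assms(2) \<open>e > 0\<close> q by (auto intro!: dvd_imp_le totient_dvd dest: prime_gt_0_nat)
    then have eeq: "totient (e * q) = totient e" using eq by simp
    show ?thesis
    proof (cases "q dvd e")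
      case True
      then have "gcd e q = q" by (simp add: gcd_nat.absorb2)
      then have "totient (e * q) * totient q = totient e * totient q * q" using totient_gcd[of e q] by simp
      then have "q = 1" using eeq e q by (simp add: prime_gt_0_nat)
      then show ?thesis using q by simp
    next
      case False
      then have "coprime e q" using q by (metis coprime_commute prime_imp_coprime)
      then have "totient e * (q - 1) = totient e" using totient_mult_coprime eeq totient_prime[OF q] by metis
      then have "q = 2" using e by simp
      then show ?thesis using False by simp
    qed
  qed
  obtain k where k: "n = d * k" using assms(1) by blast
  show ?thesis
  proof (cases "k = 1")
    case False
    then obtain p where p: "prime p" "p dvd k" using prime_factor_nat by blast
    then obtain l where l: "k = p * l" by blast
    have 1: "p = 2" "odd d" using step[of p d] p k l by auto
    have "l = 1"
    proof (rule ccontr)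
      assume "l \<noteq> 1"
      then obtain q where q: "prime q" "q dvd l" using prime_factor_nat by blast
      then have "odd (d * 2)" using step[of q "d * 2"] k l 1 by auto
      then show False by simp
    qed
    then show ?thesis using k l 1 by simp
  qed (use k in simp)
qed

section \<open>Twins in the power graph\<close>

context finite_group
begin

text \<open>Adjacency or equality in the power graph.\<close>

definition comparable :: "'a \<Rightarrow> 'a \<Rightarrow> bool" where
  "comparable x y \<longleftrightarrow> x \<preceq> y \<or> y \<preceq> x"

text \<open>Twins are elements with the same closed neighbourhood in the power graph.\<close>

definition twin :: "'a \<Rightarrow> 'a \<Rightarrow> bool" where
  "twin x y \<longleftrightarrow> (\<forall>z\<in>carrier G. comparable x z \<longleftrightarrow> comparable y z)"

text \<open>The twin class of \<open>x\<close> leaves out the identity. The identity is adjacent to everything, and keeping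
  it out makes the elements adjacent to everything no special case.\<close>

definition twin_class :: "'a \<Rightarrow> 'a set" where
  "twin_class x = {y \<in> carrier G. y \<noteq> \<one> \<and> twin x y}"

text \<open>The elements whose closed neighbourhood contains that of \<open>x\<close>.\<close>

definition dominators :: "'a \<Rightarrow> 'a set" where
  "dominators x = {v \<in> carrier G. \<forall>z\<in>carrier G. comparable x z \<longrightarrow> comparable v z}"

text \<open>A plain element is one whose twin class consists of the generators of \<open>\<langle>x\<rangle>\<close> only. As twins are
  comparable, it is enough to ask for equal orders.\<close>

definition plain :: "'a \<Rightarrow> bool" where
  "plain x \<longleftrightarrow> (\<forall>y\<in>twin_class x. ord y = ord x)"

lemma comparable_commute: "comparable x y \<longleftrightarrow> comparable y x"
  by (auto simp: comparable_def)

lemma comparable_refl: "x \<in> carrier G \<Longrightarrow> comparable x x"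
  by (simp add: comparable_def power_le_refl)

lemma comparable_ord_dvd:
  "\<lbrakk>comparable x y; x \<in> carrier G; y \<in> carrier G\<rbrakk> \<Longrightarrow> ord x dvd ord y \<or> ord y dvd ord x"
  using power_le_ord_dvd unfolding comparable_def by blast

lemma comparable_power_le:
  "\<lbrakk>comparable x y; ord x \<le> ord y; x \<in> carrier G\<rbrakk> \<Longrightarrow> x \<preceq> y"
  using power_le_ord_antisym unfolding comparable_def by blast

lemma comparable_cong:
  assumes "twin x x'" "twin y y'" "x \<in> carrier G" "y \<in> carrier G" "x' \<in> carrier G" "y' \<in> carrier G"
  shows "comparable x y \<longleftrightarrow> comparable x' y'"
  using assms unfolding twin_def by (metis comparable_commute)

lemma twin_refl: "twin x x" and twin_sym: "twin x y \<Longrightarrow> twin y x"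
  and twin_trans: "twin x y \<Longrightarrow> twin y z \<Longrightarrow> twin x z"
  by (auto simp: twin_def)

lemma twin_comparable: "\<lbrakk>twin x y; y \<in> carrier G\<rbrakk> \<Longrightarrow> comparable x y"
  using comparable_refl unfolding twin_def by blast

lemma comparable_below_prime_power:
  assumes "u \<preceq> z" "v \<preceq> z" "z \<in> carrier G" "prime p" "ord z = p ^ k"
  shows "comparable u v"
proof -
  have "ord u dvd p ^ k" "ord v dvd p ^ k" using power_le_ord_dvd assms by metis+
  then obtain i j where ij: "ord u = p ^ i" "ord v = p ^ j"
    unfolding divides_primepow_nat[OF assms(4)] by blast
  have "ord u dvd ord v \<or> ord v dvd ord u"
    unfolding ij using le_imp_power_dvd[of i j p] le_imp_power_dvd[of j i p] by linarith
  then show ?thesis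
    using power_le_iff_ord_dvd[OF assms(1-3)] power_le_iff_ord_dvd[OF assms(2,1,3)]
    unfolding comparable_def by simp
qed

lemma generators_twin:
  assumes "x \<in> carrier G" "w \<preceq> x" "ord w = ord x" shows "twin x w"
proof -
  have "x \<preceq> w" using power_le_ord_antisym assms by simp
  moreover have "w \<in> carrier G" using power_le_carrier assms by blast
  ultimately show ?thesis
    using assms power_le_trans unfolding twin_def comparable_def by blast
qed

lemma one_if_power_le_one: "x \<preceq> \<one> \<Longrightarrow> x = \<one>"
  by (auto simp: is_power_of_def)

lemma generators_subset_twin_class:
  assumes "x \<in> carrier G" "x \<noteq> \<one>" shows "{w. w \<preceq> x \<and> ord w = ord x} \<subseteq> twin_class x"
proof
  fix w assume "w \<in> {w. w \<preceq> x \<and> ord w = ord x}"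
  then have w: "w \<preceq> x" "ord w = ord x" by auto
  moreover have "w \<in> carrier G" using power_le_carrier w assms by blast
  moreover have "w \<noteq> \<one>" using w assms ord_eq_1 by (metis ord_id)
  ultimately show "w \<in> twin_class x" using generators_twin assms unfolding twin_class_def by blast
qed

lemma finite_twin_class: "finite (twin_class x)" and finite_dominators: "finite (dominators x)"
  using finite_carrier by (auto simp: twin_class_def dominators_def)

lemma totient_le_card_twin_class:
  assumes "x \<in> carrier G" "x \<noteq> \<one>" shows "totient (ord x) \<le> card (twin_class x)"
  using card_mono[OF finite_twin_class generators_subset_twin_class[OF assms]] card_generators assms by simp

lemma twin_class_plain:
  assumes "x \<in> carrier G" "x \<noteq> \<one>" "plain x" shows "twin_class x = {w. w \<preceq> x \<and> ord w = ord x}"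
proof
  show "twin_class x \<subseteq> {w. w \<preceq> x \<and> ord w = ord x}"
  proof
    fix w assume w: "w \<in> twin_class x"
    then have "w \<in> carrier G" "twin x w" by (auto simp: twin_class_def)
    moreover have "ord w = ord x" using assms(3) w by (simp add: plain_def)
    ultimately show "w \<in> {w. w \<preceq> x \<and> ord w = ord x}"
      using comparable_power_le[of w x] twin_comparable[of x w] comparable_commute by simp
  qed
qed (rule generators_subset_twin_class[OF assms(1,2)])

lemma card_twin_class_plain:
  assumes "x \<in> carrier G" "x \<noteq> \<one>" "plain x" shows "card (twin_class x) = totient (ord x)"
  using twin_class_plain card_generators assms by simp

lemma ord_gt_1: "\<lbrakk>x \<in> carrier G; x \<noteq> \<one>\<rbrakk> \<Longrightarrow> ord x > 1"
  using ord_pos ord_eq_1 by (metis less_one nat_neq_iff)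

text \<open>An element \<open>y\<close> of \<open>\<langle>x\<rangle>\<close>, neither the identity nor a generator, can be comparable to all of \<open>\<langle>x\<rangle>\<close> only
  if \<open>\<langle>x\<rangle>\<close> has prime power order.\<close>

lemma prime_power_if_comparable_to_powers:
  assumes x: "x \<in> carrier G" and y: "y \<preceq> x" "y \<noteq> \<one>" "ord y \<noteq> ord x"
    and comp: "\<And>u. u \<preceq> x \<Longrightarrow> comparable y u"
  shows "\<exists>p k. prime p \<and> ord x = p ^ k"
proof (rule prime_power_if_comparable_divisor)
  have yC: "y \<in> carrier G" using power_le_carrier x y by blast
  show dvd: "ord y dvd ord x" by (rule power_le_ord_dvd[OF y(1) x])
  show "1 < ord y" by (rule ord_gt_1[OF yC y(2)])
  show "ord y < ord x" using dvd_imp_le[OF dvd ord_pos[OF x]] y(3) by simp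
  fix d assume "d dvd ord x"
  then obtain u where u: "u \<preceq> x" "ord u = d" using exists_power_of_order x by blast
  then have "u \<in> carrier G" using power_le_carrier x by blast
  then show "d dvd ord y \<or> ord y dvd d" using comparable_ord_dvd comp yC u by blast
qed

text \<open>The other shape of a twin class: the elements of order at least \<open>p\<^sup>s\<close> in the cyclic group \<open>\<langle>a\<rangle>\<close> of
  order \<open>p\<^sup>r\<close>. In that case \<open>\<langle>a\<rangle>\<close> is also the set of dominators, and every cyclic group containing
  \<open>a\<close> is a \<open>p\<close>-group.\<close>

definition layered :: "'a \<Rightarrow> 'a \<Rightarrow> nat \<Rightarrow> nat \<Rightarrow> nat \<Rightarrow> bool" where
  "layered x a p r s \<longleftrightarrow> a \<in> carrier G \<and> twin x a \<and> prime p \<and> 0 < s \<and> s < r \<and> ord a = p ^ r \<and>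
     twin_class x = {z. z \<preceq> a \<and> p ^ s dvd ord z} \<and> dominators x = {z. z \<preceq> a} \<and>
     (\<forall>z\<in>carrier G. a \<preceq> z \<longrightarrow> (\<exists>k. ord z = p ^ k))"

lemma not_plain_imp_layered:
  assumes x: "x \<in> carrier G" "x \<noteq> \<one>" "\<not> plain x"
  shows "\<exists>a p r s. layered x a p r s"
proof -
  let ?S = "twin_class x"
  have SC: "?S \<subseteq> carrier G" by (auto simp: twin_class_def)
  have xS: "x \<in> ?S" using x twin_refl by (simp add: twin_class_def)
  have S_comp: "comparable y y'" if "y \<in> ?S" "y' \<in> ?S" for y y'
    using that twin_comparable twin_sym twin_trans unfolding twin_class_def by blast
  \<comment> \<open>Twins are pairwise comparable, so the class lies between its elements of largest and least order.\<close>
  obtain a where a: "a \<in> ?S" and amax: "\<And>w. w \<in> ?S \<Longrightarrow> ord w \<le> ord a"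
    using exists_max_ord[OF SC] xS by blast
  obtain b where b: "b \<in> ?S" and bmin: "\<And>w. w \<in> ?S \<Longrightarrow> ord b \<le> ord w"
    using ex_has_least_nat[of "\<lambda>w. w \<in> ?S" x ord] xS by blast
  obtain y where y: "y \<in> ?S" "ord y \<noteq> ord x" using x(3) by (auto simp: plain_def)
  have neq: "ord b \<noteq> ord a" using amax[OF y(1)] bmin[OF y(1)] amax[OF xS] bmin[OF xS] y(2) by simp
  have C: "a \<in> carrier G" "b \<in> carrier G" "a \<noteq> \<one>" "b \<noteq> \<one>" and tw: "twin x a" "twin x b"
    using a b by (auto simp: twin_class_def)
  have tab: "twin a b" using tw twin_sym twin_trans by blast
  have le_a: "z \<preceq> a" if "z \<in> ?S" for z
    using comparable_power_le[OF S_comp[OF that a] amax[OF that]] that SC by blast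
  have b_le: "b \<preceq> z" if "z \<in> ?S" for z
    using comparable_power_le[OF S_comp[OF b that] bmin[OF that]] C by blast
  have ba: "b \<preceq> a" by (rule le_a[OF b])
  have "comparable b u" if "u \<preceq> a" for u
    using tab that power_le_carrier[OF that C(1)] unfolding twin_def comparable_def by blast
  then obtain p r where p: "prime p" and r: "ord a = p ^ r"
    using prime_power_if_comparable_to_powers[OF C(1) ba C(4) neq] by blast
  have "ord b dvd p ^ r" using power_le_ord_dvd[OF ba C(1)] r by simp
  then obtain s where s: "ord b = p ^ s" "s \<le> r" using divides_primepow_nat[OF p] by blast
  have sr: "s < r" using s r neq by (cases "s = r") auto
  have s0: "0 < s" using ord_gt_1[OF C(2,4)] s by (cases s) auto
  have chain: "comparable u v" if "u \<preceq> a" "v \<preceq> a" for u v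
    by (rule comparable_below_prime_power[OF that C(1) p r])
  have class_eq: "?S = {z. z \<preceq> a \<and> p ^ s dvd ord z}"
  proof (intro equalityI subsetI CollectI conjI)
    fix z assume z: "z \<in> ?S"
    show "z \<preceq> a" by (rule le_a[OF z])
    show "p ^ s dvd ord z" using power_le_ord_dvd[OF b_le[OF z]] z SC s by auto
  next
    fix z assume "z \<in> {z. z \<preceq> a \<and> p ^ s dvd ord z}"
    then have z: "z \<preceq> a" "ord b dvd ord z" using s by auto
    have zC: "z \<in> carrier G" using power_le_carrier z C by blast
    have bz: "b \<preceq> z" using power_le_iff_ord_dvd[OF ba z(1) C(1)] z(2) by blast
    have "z \<noteq> \<one>" using bz C(4) one_if_power_le_one by blast
    moreover have "comparable a w \<longleftrightarrow> comparable z w" if w: "w \<in> carrier G" for w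
    proof
      assume "comparable a w"
      then show "comparable z w"
        using chain[OF z(1)] power_le_trans[OF z(1) _ w] unfolding comparable_def by blast
    next
      assume "comparable z w"
      then have "comparable b w \<or> w \<preceq> a"
        using power_le_trans[OF bz _ w] power_le_trans[OF _ z(1) C(1)] unfolding comparable_def by blast
      then show "comparable a w" using tab w unfolding twin_def comparable_def by blast
    qed
    ultimately show "z \<in> ?S"
      using zC tw(1) twin_trans unfolding twin_class_def by (auto simp: twin_def)
  qed
  have above: "\<exists>k. ord z = p ^ k" if z: "z \<in> carrier G" "a \<preceq> z" for z
  proof (rule prime_power_if_unique_prime[OF ord_pos[OF z(1)] p])
    fix q assume q: "prime q" "q dvd ord z"
    show "q = p"
    proof (rule ccontr)
      assume "q \<noteq> p"
      then have cop: "coprime (p ^ i) q" for i using p q(1) by (simp add: primes_coprime)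
      have "p ^ s dvd ord z"
        using power_le_ord_dvd[OF z(2,1)] r le_imp_power_dvd[of s r p] sr by (metis dvd_trans less_imp_le)
      \<comment> \<open>An element of order \<open>p\<^sup>s q\<close> below \<open>z\<close> is comparable to \<open>b\<close>, but not to its twin \<open>a\<close>.\<close>
      then have "p ^ s * q dvd ord z" using q(2) cop divides_mult by blast
      then obtain w where w: "w \<preceq> z" "ord w = p ^ s * q" using exists_power_of_order z(1) by blast
      have wC: "w \<in> carrier G" using power_le_carrier w z by blast
      have "b \<preceq> w"
        using power_le_iff_ord_dvd[OF power_le_trans[OF ba z(2,1)] w(1) z(1)] w(2) s by simp
      then have "comparable a w" using tab wC unfolding twin_def comparable_def by blast
      then have "p ^ r dvd p ^ s * q \<or> p ^ s * q dvd p ^ r"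
        using comparable_ord_dvd[OF _ C(1) wC] r w by simp
      then show False
      proof
        assume "p ^ r dvd p ^ s * q"
        then have "p ^ r dvd p ^ s" using cop[of r] by (simp add: coprime_dvd_mult_left_iff)
        then have "r \<le> s" using power_dvd_imp_le prime_gt_1_nat[OF p] by blast
        then show False using sr by simp
      next
        assume "p ^ s * q dvd p ^ r"
        then have "q dvd p ^ r" by (rule dvd_mult_right)
        then have "is_unit q" by (rule coprime_common_divisor[OF cop[of r] _ dvd_refl])
        then show False using q(1) not_prime_unit by blast
      qed
    qed
  qed
  have "dominators x = {z. z \<preceq> a}"
  proof (intro equalityI subsetI CollectI)
    fix v assume "v \<in> dominators x"
    then have v: "v \<in> carrier G" and dom: "\<And>w. w \<in> carrier G \<Longrightarrow> comparable a w \<Longrightarrow> comparable v w"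
      using tw(1) by (auto simp: dominators_def twin_def)
    show "v \<preceq> a"
    proof (cases "a \<preceq> v")
      case True
      then obtain k where k: "ord v = p ^ k" using above v by blast
      have "comparable v w \<Longrightarrow> comparable a w" if w: "w \<in> carrier G" for w
        using comparable_below_prime_power[OF True _ v p k, of w] power_le_trans[OF True _ w]
        unfolding comparable_def by blast
      then have "twin a v" using dom unfolding twin_def by blast
      moreover have "v \<noteq> \<one>" using True C(3) one_if_power_le_one by blast
      ultimately have "v \<in> ?S" using v tw(1) twin_trans unfolding twin_class_def by blast
      then show ?thesis by (rule le_a)
    next
      case False
      then show ?thesis using dom[OF C(1) comparable_refl[OF C(1)]] unfolding comparable_def by blast
    qed
  next
    fix z assume "z \<in> {z. z \<preceq> a}"
    then have z: "z \<preceq> a" by simp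
    have "comparable z w" if w: "w \<in> carrier G" "comparable a w" for w
      using w chain[OF z] power_le_trans[OF z _ w(1)] unfolding comparable_def by blast
    then show "z \<in> dominators x"
      using power_le_carrier[OF z C(1)] tw(1) unfolding dominators_def by (auto simp: twin_def)
  qed
  then have "layered x a p r s" using C(1) tw(1) p s0 sr r class_eq above by (simp add: layered_def)
  then show ?thesis by blast
qed

lemma card_twin_class_layered:
  assumes "layered x a p r s" shows "card (twin_class x) = p ^ r - p ^ (s - 1)"
proof -
  have a: "a \<in> carrier G" and p: "prime p" and s: "0 < s" "s < r" and r: "ord a = p ^ r"
    and class_eq: "twin_class x = {z. z \<preceq> a \<and> p ^ s dvd ord z}"
    using assms by (auto simp: layered_def)
  have "p ^ s dvd ord z \<longleftrightarrow> \<not> ord z dvd p ^ (s - 1)" if "z \<preceq> a" for z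
  proof -
    have "ord z dvd p ^ r" using power_le_ord_dvd[OF that a] r by simp
    then obtain i where i: "ord z = p ^ i" unfolding divides_primepow_nat[OF p] by blast
    show ?thesis
      unfolding i using prime_gt_1_nat[OF p] s(1) by (simp add: dvd_power_iff_le) linarith
  qed
  then have "twin_class x = {z. z \<preceq> a} - {z. z \<preceq> a \<and> ord z dvd p ^ (s - 1)}"
    unfolding class_eq by blast
  moreover have "p ^ (s - 1) dvd ord a" using r s le_imp_power_dvd[of "s - 1" r p] by simp
  then have "card {z. z \<preceq> a \<and> ord z dvd p ^ (s - 1)} = p ^ (s - 1)"
    by (rule card_powers_ord_dvd[OF a])
  moreover have "{z. z \<preceq> a \<and> ord z dvd p ^ (s - 1)} \<subseteq> {z. z \<preceq> a}" by blast
  ultimately show ?thesis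
    using card_Diff_subset[OF finite_subset[OF _ finite_powers[OF a]]] card_powers[OF a] r by metis
qed

lemma card_dominators_layered: "layered x a p r s \<Longrightarrow> card (dominators x) = p ^ r"
  using card_powers[of a] by (simp add: layered_def)

end

section \<open>The power graph\<close>

context finite_group
begin

lemma adj_power_graph:
  assumes "x \<in> carrier G" "y \<in> carrier G"
  shows "(x, y) \<in> parcs (power_graph G) \<or> x = y \<longleftrightarrow> comparable x y"
  using assms power_le_refl unfolding comparable_def power_graph_def by auto

end

text \<open>An isomorphism of power graphs that maps the identity to the identity.\<close>

locale comparability_iso = two_finite_groups G1 G2
  for G1 :: "('a, 'c) monoid_scheme" and G2 :: "('b, 'd) monoid_scheme" +
  fixes f :: "'a \<Rightarrow> 'b"
  assumes bij: "bij_betw f (carrier G1) (carrier G2)"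
    and f_one: "f \<one>\<^bsub>G1\<^esub> = \<one>\<^bsub>G2\<^esub>"
    and comparable_f: "\<And>x y. \<lbrakk>x \<in> carrier G1; y \<in> carrier G1\<rbrakk> \<Longrightarrow>
      G1.comparable x y \<longleftrightarrow> G2.comparable (f x) (f y)"
begin

lemma inverse_iso: "comparability_iso G2 G1 (inv_into (carrier G1) f)"
proof (unfold_locales)
  let ?g = "inv_into (carrier G1) f"
  show g: "bij_betw ?g (carrier G2) (carrier G1)" by (rule bij_betw_inv_into[OF bij])
  show "?g \<one>\<^bsub>G2\<^esub> = \<one>\<^bsub>G1\<^esub>"
    using bij_betw_inv_into_left[OF bij G1.one_closed] f_one by simp
  show "G2.comparable x y \<longleftrightarrow> G1.comparable (?g x) (?g y)" if "x \<in> carrier G2" "y \<in> carrier G2" for x y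
    using comparable_f[of "?g x" "?g y"] bij_betw_apply[OF g] bij_betw_inv_into_right[OF bij] that by simp
qed

lemma f_closed: "x \<in> carrier G1 \<Longrightarrow> f x \<in> carrier G2"
  by (rule bij_betw_apply[OF bij])

lemma f_surj: "y \<in> carrier G2 \<Longrightarrow> \<exists>x\<in>carrier G1. y = f x"
  using bij by (auto simp: bij_betw_def)

lemma f_eq_iff: "\<lbrakk>x \<in> carrier G1; y \<in> carrier G1\<rbrakk> \<Longrightarrow> f x = f y \<longleftrightarrow> x = y"
  using bij inj_on_eq_iff[of f "carrier G1"] by (simp add: bij_betw_def)

lemma f_eq_one_iff: "x \<in> carrier G1 \<Longrightarrow> f x = \<one>\<^bsub>G2\<^esub> \<longleftrightarrow> x = \<one>\<^bsub>G1\<^esub>"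
  using f_eq_iff[of x "\<one>\<^bsub>G1\<^esub>"] f_one by simp

lemma ball_carrier_f: "(\<forall>z\<in>carrier G2. P z) \<longleftrightarrow> (\<forall>z\<in>carrier G1. P (f z))"
  using f_surj f_closed by blast

lemma twin_f: "\<lbrakk>x \<in> carrier G1; y \<in> carrier G1\<rbrakk> \<Longrightarrow> G1.twin x y \<longleftrightarrow> G2.twin (f x) (f y)"
  unfolding G1.twin_def G2.twin_def ball_carrier_f by (simp add: comparable_f)

lemma f_Collect: "f ` {y \<in> carrier G1. P (f y)} = {y \<in> carrier G2. P y}"
  using f_surj f_closed by blast

lemma image_twin_class:
  assumes "x \<in> carrier G1" shows "f ` G1.twin_class x = G2.twin_class (f x)"
proof -
  have "G1.twin_class x = {y \<in> carrier G1. f y \<noteq> \<one>\<^bsub>G2\<^esub> \<and> G2.twin (f x) (f y)}"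
    unfolding G1.twin_class_def using assms twin_f f_eq_one_iff by blast
  then show ?thesis
    unfolding G2.twin_class_def using f_Collect[of "\<lambda>y. y \<noteq> \<one>\<^bsub>G2\<^esub> \<and> G2.twin (f x) y"] by simp
qed

lemma image_dominators:
  assumes "x \<in> carrier G1" shows "f ` G1.dominators x = G2.dominators (f x)"
proof -
  have "G1.dominators x = {v \<in> carrier G1. \<forall>z\<in>carrier G2. G2.comparable (f x) z \<longrightarrow> G2.comparable (f v) z}"
    unfolding G1.dominators_def ball_carrier_f using assms by (auto simp: comparable_f)
  then show ?thesis
    unfolding G2.dominators_def
    using f_Collect[of "\<lambda>v. \<forall>z\<in>carrier G2. G2.comparable (f x) z \<longrightarrow> G2.comparable v z"] by simp
qed

lemma card_f_image: "S \<subseteq> carrier G1 \<Longrightarrow> card (f ` S) = card S"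
  using bij by (meson bij_betw_def card_image inj_on_subset)

lemma card_twin_class_f:
  assumes "x \<in> carrier G1" shows "card (G2.twin_class (f x)) = card (G1.twin_class x)"
  using card_f_image[of "G1.twin_class x"] image_twin_class[OF assms] by (auto simp: G1.twin_class_def)

lemma card_dominators_f:
  assumes "x \<in> carrier G1" shows "card (G2.dominators (f x)) = card (G1.dominators x)"
  using card_f_image[of "G1.dominators x"] image_dominators[OF assms] by (auto simp: G1.dominators_def)

text \<open>A layered twin class of \<open>x\<close> cannot be mapped to the set of generators of a single \<open>\<langle>y\<rangle>\<close>. Counting
  twins and dominators excludes every case except \<open>s = 1\<close>, \<open>\<phi>(n) = p\<^sup>r - 1\<close>, with \<open>n = ord y\<close> not a
  prime power. In that case an element \<open>z\<close> of prime order below \<open>y\<close> has at most \<open>\<phi>(n)\<close> twins, whereas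
  its preimage generates a cyclic \<open>p\<close>-group properly containing \<open>\<langle>a\<rangle>\<close> and so has at least \<open>p\<^sup>r\<close> twins.\<close>

lemma not_plain_f:
  assumes x: "x \<in> carrier G1" "x \<noteq> \<one>\<^bsub>G1\<^esub>" "\<not> G1.plain x"
  shows "\<not> G2.plain (f x)"
proof
  assume plain: "G2.plain (f x)"
  obtain a p r s where lay: "G1.layered x a p r s" using G1.not_plain_imp_layered[OF x] by blast
  then have aC: "a \<in> carrier G1" and ta: "G1.twin x a" and p: "prime p" and s: "0 < s" "s < r"
    and r: "G1.ord a = p ^ r" and D: "G1.dominators x = {z. z \<preceq>\<^sub>1 a}"
    and above: "\<And>z. z \<in> carrier G1 \<Longrightarrow> a \<preceq>\<^sub>1 z \<Longrightarrow> \<exists>k. G1.ord z = p ^ k"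
    by (auto simp: G1.layered_def)
  define y where "y = f x"
  define n where "n = G2.ord y"
  have y: "y \<in> carrier G2" "y \<noteq> \<one>\<^bsub>G2\<^esub>" "G2.plain y"
    using x plain f_closed f_eq_one_iff by (auto simp: y_def)
  have p1: "p > 1" by (rule prime_gt_1_nat[OF p])
  have card_T: "card (G2.twin_class y) = p ^ r - p ^ (s - 1)"
    using card_twin_class_f[OF x(1)] G1.card_twin_class_layered[OF lay] by (simp add: y_def)
  have card_D: "card (G2.dominators y) = p ^ r"
    using card_dominators_f[OF x(1)] G1.card_dominators_layered[OF lay] by (simp add: y_def)
  have tot_n: "totient n = p ^ r - p ^ (s - 1)"
    using card_T G2.card_twin_class_plain[OF y] by (simp add: n_def)
  have T_sub_D: "G2.twin_class y \<subseteq> G2.dominators y"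
    by (auto simp: G2.twin_class_def G2.dominators_def G2.twin_def)
  have dom_le: "v \<preceq>\<^sub>2 y" if v: "v \<in> G2.dominators y" for v
  proof (rule ccontr)
    assume nle: "\<not> v \<preceq>\<^sub>2 y"
    have vC: "v \<in> carrier G2" and v_comp: "\<And>z. z \<in> carrier G2 \<Longrightarrow> G2.comparable y z \<Longrightarrow> G2.comparable v z"
      using v by (auto simp: G2.dominators_def)
    then have yv: "y \<preceq>\<^sub>2 v" using nle G2.comparable_refl y(1) unfolding G2.comparable_def by blast
    \<comment> \<open>The generators of \<open>\<langle>v\<rangle>\<close> would be dominators outside the twin class, at least as numerous as it.\<close>
    let ?E = "{w. w \<preceq>\<^sub>2 v \<and> G2.ord w = G2.ord v}"
    have neq: "G2.ord v \<noteq> G2.ord y" using nle G2.power_le_ord_antisym[OF yv _ vC] by auto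
    have "?E \<subseteq> G2.dominators y"
      using G2.generators_twin[OF vC] v_comp G2.power_le_carrier[OF _ vC]
      unfolding G2.dominators_def G2.twin_def by blast
    then have sub: "?E \<union> G2.twin_class y \<subseteq> G2.dominators y" using T_sub_D by blast
    have "?E \<inter> G2.twin_class y = {}" using y(3) neq by (auto simp: G2.plain_def)
    moreover have "finite ?E" using sub G2.finite_dominators finite_subset by blast
    ultimately have "card ?E + card (G2.twin_class y) = card (?E \<union> G2.twin_class y)"
      by (intro card_Un_disjoint[symmetric] G2.finite_twin_class)
    also have "\<dots> \<le> card (G2.dominators y)" by (rule card_mono[OF G2.finite_dominators sub])
    finally have "card ?E + card (G2.twin_class y) \<le> card (G2.dominators y)" .
    moreover have "n dvd G2.ord v" using G2.power_le_ord_dvd[OF yv vC] by (simp add: n_def)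
    then have "totient n \<le> totient (G2.ord v)"
      using G2.ord_pos[OF vC] by (auto intro!: dvd_imp_le totient_dvd)
    ultimately have le: "2 * (p ^ r - p ^ (s - 1)) \<le> p ^ r"
      using G2.card_generators[OF vC] tot_n card_T card_D by simp
    have "p ^ Suc s \<le> p ^ r" using s p1 by (intro power_increasing) auto
    moreover have "p ^ Suc s = p * p * p ^ (s - 1)" using s(1) by (cases s) auto
    moreover have "2 * 2 * p ^ (s - 1) \<le> p * p * p ^ (s - 1)"
      using p1 by (intro mult_le_mono1 mult_le_mono) auto
    moreover have "p ^ (s - 1) > 0" using p1 by simp
    ultimately show False using le by linarith
  qed
  have not_pp: "\<not> (\<exists>q k. prime q \<and> n = q ^ k)"
  proof
    assume "\<exists>q k. prime q \<and> n = q ^ k"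
    then obtain q k where q: "prime q" "n = q ^ k" by blast
    have "v \<in> G2.dominators y" if v: "v \<preceq>\<^sub>2 y" for v
      unfolding G2.dominators_def
      using G2.comparable_below_prime_power[OF v _ y(1) q(1)] q(2) v G2.power_le_carrier[OF v y(1)]
        G2.power_le_trans[OF v] unfolding G2.comparable_def n_def by blast
    then have "G2.dominators y = {v. v \<preceq>\<^sub>2 y}" using dom_le by blast
    then have "n = p ^ r" using card_D G2.card_powers[OF y(1)] by (simp add: n_def)
    then have "p ^ r - p ^ (s - 1) = p ^ (r - 1) * (p - 1)"
      using tot_n totient_prime_power[OF p] s by simp
    also have "\<dots> = p ^ r - p ^ (r - 1)" using s by (cases r) (auto simp: algebra_simps)
    finally have "p ^ r - p ^ (s - 1) = p ^ r - p ^ (r - 1)" .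
    moreover have "p ^ (s - 1) < p ^ (r - 1)" "p ^ (r - 1) \<le> p ^ r"
      using p1 s by (auto intro!: power_strict_increasing power_increasing)
    ultimately show False by linarith
  qed
  \<comment> \<open>Hence the dominators of \<open>y\<close> are its twins and the identity.\<close>
  have dom: "v = \<one>\<^bsub>G2\<^esub> \<or> v \<in> G2.twin_class y" if v: "v \<in> G2.dominators y" for v
  proof (rule ccontr)
    assume neg: "\<not> (v = \<one>\<^bsub>G2\<^esub> \<or> v \<in> G2.twin_class y)"
    have vy: "v \<preceq>\<^sub>2 y" by (rule dom_le[OF v])
    then have "G2.ord v \<noteq> G2.ord y" using neg G2.generators_subset_twin_class[OF y(1,2)] by blast
    moreover have "G2.comparable v u" if "u \<preceq>\<^sub>2 y" for u
      using v that G2.power_le_carrier[OF that y(1)] unfolding G2.dominators_def G2.comparable_def by blast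
    ultimately show False
      using G2.prime_power_if_comparable_to_powers[OF y(1) vy] neg not_pp unfolding n_def by blast
  qed
  have "\<one>\<^bsub>G2\<^esub> \<in> G2.dominators y"
    using G2.one_power_le unfolding G2.dominators_def G2.comparable_def by simp
  then have "G2.dominators y = insert \<one>\<^bsub>G2\<^esub> (G2.twin_class y)" using dom T_sub_D by blast
  moreover have "\<one>\<^bsub>G2\<^esub> \<notin> G2.twin_class y" by (simp add: G2.twin_class_def)
  ultimately have "p ^ r = Suc (p ^ r - p ^ (s - 1))"
    using card_D card_T G2.finite_twin_class by simp
  then have tot_lt: "totient n < p ^ r" using tot_n by simp
  have n1: "n > 1" using G2.ord_gt_1 y by (simp add: n_def)
  then obtain d where d: "prime d" "d dvd n" using prime_factor_nat[of n] by auto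
  have dn: "d \<noteq> n" using not_pp d(1) power_one_right by metis
  obtain z where z: "z \<preceq>\<^sub>2 y" "G2.ord z = d" using G2.exists_power_of_order[OF y(1)] d(2) n_def by blast
  have zC: "z \<in> carrier G2" by (rule G2.power_le_carrier[OF z(1) y(1)])
  have z1: "z \<noteq> \<one>\<^bsub>G2\<^esub>" using z(2) d(1) by auto
  have z_dom: "z \<notin> G2.dominators y" using dom z1 dn y(3) z(2) unfolding G2.plain_def n_def by blast
  \<comment> \<open>Otherwise \<open>y\<close>, being adjacent to \<open>z\<close>, would have prime power order.\<close>
  have z_plain: "G2.plain z"
  proof (rule ccontr)
    assume "\<not> G2.plain z"
    then obtain b q k l where "G2.layered z b q k l" using G2.not_plain_imp_layered[OF zC z1] by blast
    then have bC: "b \<in> carrier G2" and tb: "G2.twin z b" and q: "prime q" and k: "G2.ord b = q ^ k"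
      and above_b: "\<And>w. w \<in> carrier G2 \<Longrightarrow> b \<preceq>\<^sub>2 w \<Longrightarrow> \<exists>k. G2.ord w = q ^ k"
      by (auto simp: G2.layered_def)
    have "G2.comparable b y"
      using tb z(1) y(1) unfolding G2.twin_def G2.comparable_def by blast
    then have "\<exists>k. n = q ^ k"
      unfolding G2.comparable_def
    proof
      assume "y \<preceq>\<^sub>2 b"
      then have "n dvd q ^ k" using G2.power_le_ord_dvd[OF _ bC] k by (metis n_def)
      then show ?thesis using divides_primepow_nat[OF q] by blast
    qed (use above_b y(1) n_def in blast)
    then show False using not_pp q by blast
  qed
  obtain u where u: "u \<in> carrier G1" "z = f u" using f_surj zC by blast
  have "u \<noteq> \<one>\<^bsub>G1\<^esub>" using z1 u f_eq_one_iff by blast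
  have "u \<notin> G1.dominators x" using z_dom image_dominators[OF x(1)] u y_def by blast
  then have nua: "\<not> u \<preceq>\<^sub>1 a" using D by blast
  have "G1.comparable x u" using comparable_f[OF x(1) u(1)] z(1) u(2) y_def unfolding G2.comparable_def by simp
  then have au: "a \<preceq>\<^sub>1 u" using nua ta u(1) unfolding G1.twin_def G1.comparable_def by blast
  then obtain k where k: "G1.ord u = p ^ k" using above u(1) by blast
  have "p ^ r < p ^ k"
    using nua G1.power_le_ord_antisym[OF au _ u(1)] r k by (metis not_le)
  then have "r < k" using p1 power_less_imp_less_exp by blast
  then have "p ^ r \<le> p ^ (k - 1)" using p1 by (intro power_increasing) auto
  also have "\<dots> \<le> p ^ (k - 1) * (p - 1)" using p1 by simp
  also have "\<dots> = totient (G1.ord u)" using totient_prime_power[OF p] k \<open>r < k\<close> by simp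
  also have "\<dots> \<le> card (G1.twin_class u)"
    by (rule G1.totient_le_card_twin_class[OF u(1) \<open>u \<noteq> \<one>\<^bsub>G1\<^esub>\<close>])
  also have "\<dots> = card (G2.twin_class z)" using card_twin_class_f[OF u(1)] u(2) by simp
  also have "\<dots> = totient d" using G2.card_twin_class_plain[OF zC z1 z_plain] z(2) by simp
  also have "\<dots> \<le> totient n" using d(2) n1 by (auto intro!: dvd_imp_le totient_dvd)
  finally show False using tot_lt by simp
qed

lemma plain_f:
  assumes "x \<in> carrier G1" "x \<noteq> \<one>\<^bsub>G1\<^esub>" "G1.plain x"
  shows "G2.plain (f x)"
  using comparability_iso.not_plain_f[OF inverse_iso, of "f x"] assms f_closed f_eq_one_iff
    bij_betw_inv_into_left[OF bij] by auto

text \<open>The corrected correspondence. A match of \<open>x\<close> is a twin of \<open>f x\<close> that generates a subgroup with as many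
  generators as \<open>\<langle>x\<rangle>\<close>. This condition does not separate the identity from an involution adjacent to
  everything, hence the extra clause.\<close>

definition matched :: "'a \<Rightarrow> 'b \<Rightarrow> bool" where
  "matched x y \<longleftrightarrow> x \<in> carrier G1 \<and> y \<in> carrier G2 \<and> (x = \<one>\<^bsub>G1\<^esub> \<longleftrightarrow> y = \<one>\<^bsub>G2\<^esub>) \<and>
     G2.twin (f x) y \<and> totient (G1.ord x) = totient (G2.ord y)"

lemma matched_inverse: "comparability_iso.matched G2 G1 (inv_into (carrier G1) f) y x \<longleftrightarrow> matched x y"
proof -
  let ?g = "inv_into (carrier G1) f"
  have "G1.twin (?g y) x \<longleftrightarrow> G2.twin (f x) y" if "x \<in> carrier G1" "y \<in> carrier G2"
  proof -
    have g: "?g y \<in> carrier G1" "f (?g y) = y"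
      using bij_betw_apply[OF bij_betw_inv_into[OF bij]] bij_betw_inv_into_right[OF bij] that by auto
    show ?thesis using twin_f[OF g(1) that(1)] g(2) G2.twin_sym by auto
  qed
  then show ?thesis unfolding matched_def comparability_iso.matched_def[OF inverse_iso] by auto
qed

lemma exists_matched:
  assumes x: "x \<in> carrier G1" shows "\<exists>y. matched x y"
proof (cases "x = \<one>\<^bsub>G1\<^esub>")
  case True
  then have "matched x \<one>\<^bsub>G2\<^esub>" using f_one G2.twin_refl by (simp add: matched_def)
  then show ?thesis by blast
next
  case x1: False
  have fx: "f x \<in> carrier G2" "f x \<noteq> \<one>\<^bsub>G2\<^esub>" using x x1 f_closed f_eq_one_iff by auto
  show ?thesis
  proof (cases "G1.plain x")
    case True
    then have "totient (G1.ord x) = totient (G2.ord (f x))"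
      using G1.card_twin_class_plain[OF x x1] G2.card_twin_class_plain[OF fx plain_f[OF x x1]]
        card_twin_class_f[OF x] by simp
    then have "matched x (f x)" using x x1 fx G2.twin_refl by (simp add: matched_def)
    then show ?thesis by blast
  next
    case False
    obtain a p r s where l1: "G1.layered x a p r s"
      using G1.not_plain_imp_layered[OF x x1 False] by blast
    then have aC: "a \<in> carrier G1" and p: "prime p" and s: "0 < s" "s < r" and r: "G1.ord a = p ^ r"
      and T: "G1.twin_class x = {z. z \<preceq>\<^sub>1 a \<and> p ^ s dvd G1.ord z}"
      by (auto simp: G1.layered_def)
    obtain b q t u where l2: "G2.layered (f x) b q t u"
      using G2.not_plain_imp_layered[OF fx not_plain_f[OF x x1 False]] by blast
    then have bC: "b \<in> carrier G2" and q: "prime q" and u: "0 < u" "u < t" and t: "G2.ord b = q ^ t"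
      and T': "G2.twin_class (f x) = {z. z \<preceq>\<^sub>2 b \<and> q ^ u dvd G2.ord z}"
      by (auto simp: G2.layered_def)
    have pq: "p ^ r = q ^ t"
      using card_dominators_f[OF x] G1.card_dominators_layered[OF l1] G2.card_dominators_layered[OF l2]
      by simp
    have "p dvd q ^ t" using pq s by (metis dvd_power gr_implies_not0 neq0_conv)
    then have "p dvd q" using p prime_dvd_power by blast
    then have "p = q" using p q primes_dvd_imp_eq by blast
    then have "r = t" using pq prime_gt_1_nat[OF p] power_inject_exp by blast
    have "p ^ r - p ^ (s - 1) = p ^ r - p ^ (u - 1)"
      using card_twin_class_f[OF x] G1.card_twin_class_layered[OF l1]
        G2.card_twin_class_layered[OF l2] \<open>p = q\<close> \<open>r = t\<close> by simp
    moreover have "p ^ (s - 1) \<le> p ^ r" "p ^ (u - 1) \<le> p ^ r"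
      using prime_gt_1_nat[OF p] s u \<open>r = t\<close> by (auto intro!: power_increasing)
    ultimately have "p ^ (s - 1) = p ^ (u - 1)" by linarith
    then have "s = u" using prime_gt_1_nat[OF p] s u power_inject_exp[of p "s - 1" "u - 1"] by simp
    have "x \<in> G1.twin_class x" using x x1 G1.twin_refl by (simp add: G1.twin_class_def)
    then have xa: "x \<preceq>\<^sub>1 a" "p ^ s dvd G1.ord x" using T by auto
    then have "G1.ord x dvd G2.ord b" using G1.power_le_ord_dvd[OF _ aC] r t pq by simp
    then obtain y where y: "y \<preceq>\<^sub>2 b" "G2.ord y = G1.ord x" using G2.exists_power_of_order bC by blast
    then have "y \<in> G2.twin_class (f x)" using T' xa(2) \<open>p = q\<close> \<open>s = u\<close> by simp
    then have "matched x y" using x x1 y(2) by (simp add: matched_def G2.twin_class_def)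
    then show ?thesis by blast
  qed
qed

lemma matched_comparable:
  assumes "matched x y" "matched x' y'" shows "G1.comparable x x' \<longleftrightarrow> G2.comparable y y'"
  using assms comparable_f f_closed G2.comparable_cong[of "f x" y "f x'" y'] by (auto simp: matched_def)

lemma matched_power_le:
  assumes xy: "matched x y" and xy': "matched x' y'" and le: "x \<preceq>\<^sub>1 x'"
  shows "y \<preceq>\<^sub>2 y'"
proof (rule ccontr)
  assume nle: "\<not> y \<preceq>\<^sub>2 y'"
  have C: "x \<in> carrier G1" "x' \<in> carrier G1" "y \<in> carrier G2" "y' \<in> carrier G2"
    using xy xy' by (auto simp: matched_def)
  have "y \<noteq> \<one>\<^bsub>G2\<^esub>" using nle G2.one_power_le by blast
  then have "x \<noteq> \<one>\<^bsub>G1\<^esub>" using xy by (auto simp: matched_def)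
  then have "x' \<noteq> \<one>\<^bsub>G1\<^esub>" using le G1.one_if_power_le_one by blast
  then have "y' \<noteq> \<one>\<^bsub>G2\<^esub>" using xy' by (auto simp: matched_def)
  have "G1.comparable x x'" using le by (simp add: G1.comparable_def)
  then have ge: "y' \<preceq>\<^sub>2 y" using matched_comparable[OF xy xy'] nle by (auto simp: G2.comparable_def)
  have dvd: "G1.ord x dvd G1.ord x'" "G2.ord y' dvd G2.ord y"
    using G1.power_le_ord_dvd[OF le C(2)] G2.power_le_ord_dvd[OF ge C(3)] .
  have pos: "G1.ord x' > 0" "G2.ord y > 0" using G1.ord_pos G2.ord_pos C by auto
  have "totient (G1.ord x) \<le> totient (G1.ord x')" "totient (G2.ord y') \<le> totient (G2.ord y)"
    using dvd pos by (auto intro!: dvd_imp_le totient_dvd)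
  moreover have "totient (G1.ord x) = totient (G2.ord y)" "totient (G1.ord x') = totient (G2.ord y')"
    using xy xy' by (auto simp: matched_def)
  ultimately have tot: "totient (G1.ord x) = totient (G1.ord x')" "totient (G2.ord y') = totient (G2.ord y)"
    by auto
  have "G2.ord y \<noteq> G2.ord y'" using G2.power_le_ord_antisym[OF ge _ C(3)] nle by auto
  then have y2: "G2.ord y = 2 * G2.ord y'" "odd (G2.ord y')"
    using totient_dvd_eq_cases[OF dvd(2) pos(2) tot(2)] by auto
  \<comment> \<open>The order of \<open>y'\<close> is odd and not one, so no involution is comparable to \<open>y'\<close>. The involution
    constructed here lies below \<open>y\<close>, then a twin of \<open>y'\<close>, or matches one below \<open>x'\<close>.\<close>
  have "\<exists>t. t \<in> carrier G2 \<and> G2.ord t = 2 \<and> G2.comparable t y'"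
    using totient_dvd_eq_cases[OF dvd(1) pos(1) tot(1)]
  proof
    assume eq: "G1.ord x' = G1.ord x"
    obtain t where t: "t \<preceq>\<^sub>2 y" "G2.ord t = 2"
      using G2.exists_power_of_order[OF C(3), of 2] y2(1) by (metis dvd_triv_left)
    have "G1.twin x x'" using G1.generators_twin[OF C(2) le] eq G1.twin_sym by simp
    then have "G2.twin (f x) (f x')" using twin_f[OF C(1,2)] by simp
    then have "G2.twin y y'" using xy xy' G2.twin_sym G2.twin_trans unfolding matched_def by blast
    moreover have tC: "t \<in> carrier G2" by (rule G2.power_le_carrier[OF t(1) C(3)])
    ultimately have "G2.comparable t y'" using t(1) unfolding G2.twin_def G2.comparable_def by blast
    then show ?thesis using t tC by blast
  next
    assume eq: "G1.ord x' = 2 * G1.ord x \<and> odd (G1.ord x)"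
    obtain v where v: "v \<preceq>\<^sub>1 x'" "G1.ord v = 2"
      using G1.exists_power_of_order[OF C(2), of 2] eq by (metis dvd_triv_left)
    have vC: "v \<in> carrier G1" by (rule G1.power_le_carrier[OF v(1) C(2)])
    obtain t where t: "matched v t" using exists_matched[OF vC] by blast
    then have tC: "t \<in> carrier G2" by (simp add: matched_def)
    have "v \<noteq> \<one>\<^bsub>G1\<^esub>" using v(2) by auto
    then have "G2.ord t > 1" using t G2.ord_gt_1 by (auto simp: matched_def)
    moreover have "totient (G2.ord t) = 1" using t v(2) by (simp add: matched_def)
    ultimately have "G2.ord t = 2" using totient_gt_1[of "G2.ord t"] by force
    moreover have "G2.comparable t y'"
      using matched_comparable[OF t xy'] v(1) unfolding G1.comparable_def by blast
    ultimately show ?thesis using tC by blast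
  qed
  then obtain t where t: "t \<in> carrier G2" "G2.ord t = 2" "G2.comparable t y'" by blast
  then have "2 dvd G2.ord y' \<or> G2.ord y' dvd 2" using G2.comparable_ord_dvd C(4) by metis
  then have "G2.ord y' dvd 2" using y2(2) by blast
  then have "G2.ord y' = 1" using y2(2) by (metis dvd_refl primes_dvd_imp_eq prime_nat_iff two_is_prime_nat)
  then show False using G2.ord_eq_1 C(4) \<open>y' \<noteq> \<one>\<^bsub>G2\<^esub>\<close> by blast
qed

lemma cyclic_subgroup_graphs_iso:
  "digraph_iso (with_proj (cyclic_subgroup_graph G1)) (with_proj (cyclic_subgroup_graph G2))"
proof (rule cyclic_subgroup_graph_iso[of matched])
  show "x \<in> carrier G1 \<and> y \<in> carrier G2" if "matched x y" for x y using that by (simp add: matched_def)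
  show "\<exists>y. matched x y" if "x \<in> carrier G1" for x by (rule exists_matched[OF that])
  show "\<exists>x. matched x y" if "y \<in> carrier G2" for y
    using comparability_iso.exists_matched[OF inverse_iso that] matched_inverse by simp
  show "x \<preceq>\<^sub>1 x' \<longleftrightarrow> y \<preceq>\<^sub>2 y'" if "matched x y" "matched x' y'" for x y x' y'
    using matched_power_le[OF that] comparability_iso.matched_power_le[OF inverse_iso, of y x y' x']
      that matched_inverse by blast
qed

end

context two_finite_groups
begin

lemma power_graph_determines:
  assumes "digraph_iso (with_proj (power_graph G1)) (with_proj (power_graph G2))"
  shows "digraph_iso (with_proj (cyclic_subgroup_graph G1)) (with_proj (cyclic_subgroup_graph G2))"
proof -
  obtain f where bij: "bij_betw f (carrier G1) (carrier G2)"
    and adj: "\<And>x y. x \<in> carrier G1 \<Longrightarrow> y \<in> carrier G1 \<Longrightarrow>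
      (x, y) \<in> parcs (power_graph G1) \<longleftrightarrow> (f x, f y) \<in> parcs (power_graph G2)"
    using assms unfolding digraph_iso_with_proj_iff[OF pair_wf_power_graph pair_wf_power_graph]
    by (auto simp: power_graph_def)
  have comp: "G1.comparable x y \<longleftrightarrow> G2.comparable (f x) (f y)"
    if "x \<in> carrier G1" "y \<in> carrier G1" for x y
    using G1.adj_power_graph[OF that] G2.adj_power_graph[of "f x" "f y"] adj[OF that]
      bij that by (metis bij_betw_apply bij_betw_imp_inj_on inj_onD)
  let ?e = "f \<one>\<^bsub>G1\<^esub>"
  \<comment> \<open>The identity and \<open>f \<one>\<close> are twins, so exchanging them is an automorphism of the power graph.\<close>
  let ?h = "transpose ?e \<one>\<^bsub>G2\<^esub>"
  have eC: "?e \<in> carrier G2" using bij_betw_apply[OF bij] by simp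
  have "G2.comparable ?e w" if "w \<in> carrier G2" for w
  proof -
    have "w \<in> f ` carrier G1" using that bij by (simp add: bij_betw_def)
    then obtain x where "x \<in> carrier G1" "w = f x" by blast
    then show ?thesis using comp[of "\<one>\<^bsub>G1\<^esub>" x] G1.one_power_le by (auto simp: G1.comparable_def)
  qed
  then have "G2.twin ?e \<one>\<^bsub>G2\<^esub>" using G2.one_power_le by (auto simp: G2.twin_def G2.comparable_def)
  then have h_twin: "G2.twin (?h w) w" for w
    using G2.twin_refl G2.twin_sym by (auto simp: transpose_def)
  have h_bij: "bij_betw ?h (carrier G2) (carrier G2)"
    by (rule bij_betw_transpose_iff) (use eC in auto)
  interpret comparability_iso G1 G2 "?h \<circ> f"
  proof unfold_locales
    show "bij_betw (?h \<circ> f) (carrier G1) (carrier G2)" by (rule bij_betw_trans[OF bij h_bij])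
    show "(?h \<circ> f) \<one>\<^bsub>G1\<^esub> = \<one>\<^bsub>G2\<^esub>" by simp
    fix x y assume xy: "x \<in> carrier G1" "y \<in> carrier G1"
    have "f x \<in> carrier G2" "f y \<in> carrier G2" using xy bij_betw_apply[OF bij] by auto
    moreover from this have "?h (f x) \<in> carrier G2" "?h (f y) \<in> carrier G2" using bij_betw_apply[OF h_bij] by auto
    ultimately have "G2.comparable (?h (f x)) (?h (f y)) \<longleftrightarrow> G2.comparable (f x) (f y)"
      by (intro G2.comparable_cong h_twin)
    then show "G1.comparable x y \<longleftrightarrow> G2.comparable ((?h \<circ> f) x) ((?h \<circ> f) y)" using comp[OF xy] by simp
  qed
  show ?thesis by (rule cyclic_subgroup_graphs_iso)
qed

end

section \<open>Both graphs determine the cyclic subgroup graph\<close>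

theorem theorem5p1:
  fixes G1 :: "('a, 'c) monoid_scheme" and G2 :: "('b, 'd) monoid_scheme"
  assumes "group G1" "finite (carrier G1)"
    and "group G2" "finite (carrier G2)"
  shows "(digraph_iso (with_proj (power_graph G1)) (with_proj (power_graph G2)) \<longrightarrow>
            digraph_iso (with_proj (cyclic_subgroup_graph G1)) (with_proj (cyclic_subgroup_graph G2))) \<and>
         (digraph_iso (with_proj (enhanced_power_graph G1)) (with_proj (enhanced_power_graph G2)) \<longrightarrow>
            digraph_iso (with_proj (cyclic_subgroup_graph G1)) (with_proj (cyclic_subgroup_graph G2)))"
proof -
  interpret two_finite_groups G1 G2
    using assms by (simp add: two_finite_groups_def finite_group_def finite_group_axioms_def)
  show ?thesis
    using power_graph_determines enhanced_power_graph_determines by blast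
qed

end
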